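(* Let $k\ge1$ and let $W_a$ be the affine Weyl group of type $\widetilde C_k$ acting on $V=\mathbb{R}^k$, with fundamental alcove $\mathcal A=\{x\in\mathbb{R}^k:1/2>x_1>\cdots>x_k>0\}$. Let $X=(X^1,\dots,X^k)$ be a reflectable process in $\mathbb{R}^k$ (with respect to $W_a$) having independent components in orthogonal directions, let $x\in\mathcal A$, and let $\widetilde T$ be the first exit time of $X$ from $\mathcal A$. Then for every $t\ge0$ $$\mathbb{P}_x(\widetilde T>t)=\begin{cases}\mathrm{Pf}(\check p_{ij})_{i,j\in[k]} & \text{if $k$ is even},\\[2pt] \displaystyle\sum_{l=1}^k(-1)^{l-1}\,\check p_l\,\mathrm{Pf}(\check p_{ij})_{i,j\in[k]\setminus\{l\}} & \text{if $k$ is odd},\end{cases}$$ where for $i<j$, $\check p_{ij}=\mathbb{P}_x(\forall s\le t,\ 1/2>X^i_s>X^j_s>0)$, $\check p_{ji}=-\check p_{ij}$, and $\check p_i=\mathbb{P}_x(\forall s\le t,\ 1/2>X^i_s>0)$.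
   Context: $[k]=\{1,\dots,k\}$. $W_a$ consists of the maps $x\mapsto w(x)+d$, with $w$ a signed permutation of the coordinates of $\mathbb{R}^k$ and $d\in L=\mathbb{Z}^k$. $X=(X_t)_{t\ge0}$ has law $\mathbb{P}_x$ when started at $x$; it is reflectable if it has the strong Markov property, almost surely continuous sample paths, and $W_a$-invariant law: $\mathbb{P}_x\circ(wX)^{-1}=\mathbb{P}_{wx}\circ X^{-1}$ for all $w\in W_a$, $x\in V$. "Independent components in orthogonal directions" means that under each $\mathbb{P}_x$ the projections of $X$ onto pairwise orthogonal subspaces are independent processes. $\mathrm{Pf}$ denotes the Pfaffian: $\mathrm{Pf}(a_{ij})=\sum_\pi(-1)^{c(\pi)}\prod_{\{i<j\}\in\pi}a_{ij}$, summed over partitions $\pi$ of the (ordered) index set into pairs, $c(\pi)$ being the number of crossings (pairs of blocks $\{i<j\},\{i'<j'\}$ with $i<i'<j<j'$); the Pfaffian over the empty set is $1$. *)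

theory Defs
  imports "HOL-Probability.Probability"
begin

section \<open>The affine Weyl group of type C and its fundamental alcove\<close>

text \<open>The index set $\{1,\dots,k\}$ is an arbitrary finite linearly ordered type \<open>'n\<close>, with
  $k$ = \<open>CARD('n)\<close>. Up to order isomorphism this is $\{1<\dots<k\}$, and every $k \ge 1$ occurs.\<close>

definition signed_permutation :: "(real^'n \<Rightarrow> real^'n) \<Rightarrow> bool" where
  "signed_permutation w \<longleftrightarrow>
     (\<exists>\<sigma> \<epsilon>. bij \<sigma> \<and> (\<forall>i. \<epsilon> i \<in> {-1, 1}) \<and> w = (\<lambda>x. \<chi> i. \<epsilon> i * x $ \<sigma> i))"

definition affine_weyl_C :: "(real^'n \<Rightarrow> real^'n) set" where
  "affine_weyl_C = {\<lambda>x. w x + d | w d. signed_permutation w \<and> (\<forall>i. d $ i \<in> \<int>)}"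

definition alcove_C :: "(real^'n::{finite,linorder}) set" where
  "alcove_C = {x. (\<forall>i. 0 < x $ i \<and> x $ i < 1/2) \<and> (\<forall>i j. i < j \<longrightarrow> x $ i > x $ j)}"

section \<open>Reflectable processes\<close>

text \<open>A process is a map \<open>X\<close> (used at times $\ge 0$ only) on a measurable space \<open>M\<close>, together with
  a family \<open>P\<close> of probability measures on \<open>M\<close>, where \<open>P x\<close> is the law under which \<open>X\<close> starts
  at \<open>x\<close>.\<close>

definition path_space :: "(real \<Rightarrow> 'v::topological_space) measure" where
  "path_space = Pi\<^sub>M {0..} (\<lambda>_. borel)"

definition path :: "(real \<Rightarrow> 'w \<Rightarrow> 'v) \<Rightarrow> 'w \<Rightarrow> real \<Rightarrow> 'v" where
  "path X \<omega> = (\<lambda>t\<in>{0..}. X t \<omega>)"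

definition process_family ::
  "'w measure \<Rightarrow> ('v::topological_space \<Rightarrow> 'w measure) \<Rightarrow> (real \<Rightarrow> 'w \<Rightarrow> 'v) \<Rightarrow> bool" where
  "process_family M P X \<longleftrightarrow>
     (\<forall>t\<ge>0. X t \<in> M \<rightarrow>\<^sub>M borel) \<and>
     (\<forall>x. prob_space (P x) \<and> sets (P x) = sets M \<and> (AE \<omega> in P x. X 0 \<omega> = x)) \<and>
     (\<forall>B\<in>sets path_space. (\<lambda>x. \<P>(\<omega> in P x. path X \<omega> \<in> B)) \<in> borel_measurable borel)"

definition natural_filtration ::
  "'w measure \<Rightarrow> (real \<Rightarrow> 'w \<Rightarrow> 'v::topological_space) \<Rightarrow> ennreal \<Rightarrow> 'w measure" where
  "natural_filtration M X u =
     vimage_algebra (space M) (\<lambda>\<omega>. \<lambda>s\<in>{s. 0 \<le> s \<and> ennreal s \<le> u}. X s \<omega>)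
       (Pi\<^sub>M {s. 0 \<le> s \<and> ennreal s \<le> u} (\<lambda>_. borel))"

text \<open>The strong Markov property, for $[0,\infty]$-valued stopping times \<open>T\<close> of the raw natural
  filtration: on $\{T < \infty\}$, the conditional law of $(X_{T+s})_{s\ge 0}$ given the past
  up to \<open>T\<close> is the law of \<open>X\<close> started at $X_T$. As paths will only be almost surely continuous,
  events involving $X_T$ are measurable only up to null sets, hence the completion.\<close>

definition strong_markov ::
  "'w measure \<Rightarrow> ('v::topological_space \<Rightarrow> 'w measure) \<Rightarrow> (real \<Rightarrow> 'w \<Rightarrow> 'v) \<Rightarrow> bool" where
  "strong_markov M P X \<longleftrightarrow>
     (\<forall>x. \<forall>T :: 'w \<Rightarrow> ennreal. stopping_time (natural_filtration M X) T \<longrightarrow>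
       (\<forall>B\<in>sets path_space. AE \<omega> in P x. T \<omega> < \<infinity> \<longrightarrow>
          real_cond_exp (completion (P x))
            (filtration.pre_sigma (space M) (natural_filtration M X) T)
            (indicator {\<omega>\<in>space M. T \<omega> < \<infinity> \<and> path (\<lambda>s. X (enn2real (T \<omega>) + s)) \<omega> \<in> B}) \<omega>
          = \<P>(\<omega>' in P (X (enn2real (T \<omega>)) \<omega>). path X \<omega>' \<in> B)))"

definition law :: "'w measure \<Rightarrow> (real \<Rightarrow> 'w \<Rightarrow> 'v::topological_space) \<Rightarrow> (real \<Rightarrow> 'v) measure" where
  "law Q X = distr Q path_space (path X)"

definition reflectable ::
  "('v \<Rightarrow> 'v) set \<Rightarrow> 'w measure \<Rightarrow> ('v::topological_space \<Rightarrow> 'w measure) \<Rightarrow> (real \<Rightarrow> 'w \<Rightarrow> 'v) \<Rightarrow> bool"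
where
  "reflectable W M P X \<longleftrightarrow>
     process_family M P X \<and>
     strong_markov M P X \<and>
     (\<forall>x. AE \<omega> in P x. continuous_on {0..} (\<lambda>t. X t \<omega>)) \<and>
     (\<forall>w\<in>W. \<forall>x. law (P x) (\<lambda>t \<omega>. w (X t \<omega>)) = law (P (w x)) X)"

definition orth_proj :: "'v::euclidean_space set \<Rightarrow> 'v \<Rightarrow> 'v" where
  "orth_proj S x = (THE y. y \<in> S \<and> (\<forall>z\<in>S. orthogonal (x - y) z))"

definition indep_orthogonal_components ::
  "('v::euclidean_space \<Rightarrow> 'w measure) \<Rightarrow> (real \<Rightarrow> 'w \<Rightarrow> 'v) \<Rightarrow> bool" where
  "indep_orthogonal_components P X \<longleftrightarrow>
     (\<forall>\<S> :: 'v set set.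
        (\<forall>S\<in>\<S>. subspace S) \<and> pairwise (\<lambda>S S'. \<forall>u\<in>S. \<forall>v\<in>S'. orthogonal u v) \<S> \<longrightarrow>
        (\<forall>x. prob_space.indep_vars (P x) (\<lambda>_. path_space)
               (\<lambda>S. path (\<lambda>t \<omega>. orth_proj S (X t \<omega>))) \<S>))"

definition exit_time :: "(real \<Rightarrow> 'w \<Rightarrow> 'v) \<Rightarrow> 'v set \<Rightarrow> 'w \<Rightarrow> ennreal" where
  "exit_time X A \<omega> = (INF s\<in>{s. 0 \<le> s \<and> X s \<omega> \<notin> A}. ennreal s)"

section \<open>Pfaffians\<close>

definition pairings :: "'i set \<Rightarrow> 'i set set set" where
  "pairings I = {\<pi>. partition_on I \<pi> \<and> (\<forall>b\<in>\<pi>. card b = 2)}"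

text \<open>A pair of crossing blocks is counted once, with the block of smaller minimum first.\<close>

definition crossings :: "'i::linorder set set \<Rightarrow> nat" where
  "crossings \<pi> =
     card {(b, b'). b \<in> \<pi> \<and> b' \<in> \<pi> \<and> Min b < Min b' \<and> Min b' < Max b \<and> Max b < Max b'}"

definition pfaffian :: "'i::linorder set \<Rightarrow> ('i \<Rightarrow> 'i \<Rightarrow> real) \<Rightarrow> real" where
  "pfaffian I a = (\<Sum>\<pi>\<in>pairings I. (-1) ^ crossings \<pi> * (\<Prod>b\<in>\<pi>. a (Min b) (Max b)))"

section \<open>One- and two-coordinate survival probabilities\<close>

text \<open>Events involving all times in $[0,t]$ are measurable only up to null sets (the paths being
  only almost surely continuous), so probabilities are taken in the completion.\<close>

definition p_single ::
  "(real^'n \<Rightarrow> 'w measure) \<Rightarrow> (real \<Rightarrow> 'w \<Rightarrow> real^'n) \<Rightarrow> real^'n \<Rightarrow> real \<Rightarrow> 'n \<Rightarrow> real" where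
  "p_single P X x t i =
     \<P>(\<omega> in completion (P x). \<forall>s\<in>{0..t}. 1/2 > X s \<omega> $ i \<and> X s \<omega> $ i > 0)"

definition p_ordered ::
  "(real^'n \<Rightarrow> 'w measure) \<Rightarrow> (real \<Rightarrow> 'w \<Rightarrow> real^'n) \<Rightarrow> real^'n \<Rightarrow> real \<Rightarrow> 'n \<Rightarrow> 'n \<Rightarrow> real" where
  "p_ordered P X x t i j =
     \<P>(\<omega> in completion (P x).
          \<forall>s\<in>{0..t}. 1/2 > X s \<omega> $ i \<and> X s \<omega> $ i > X s \<omega> $ j \<and> X s \<omega> $ j > 0)"

definition p_pair ::
  "(real^'n::{finite,linorder} \<Rightarrow> 'w measure) \<Rightarrow> (real \<Rightarrow> 'w \<Rightarrow> real^'n::{finite,linorder})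
     \<Rightarrow> real^'n::{finite,linorder} \<Rightarrow> real \<Rightarrow> 'n \<Rightarrow> 'n \<Rightarrow> real" where
  "p_pair P X x t i j =
     (if i < j then p_ordered P X x t i j
      else if j < i then - p_ordered P X x t j i
      else 0)"

end

theory Submission
  imports Defs
begin

text \<open>Sum over matchings \<open>Q\<close> of the index set the signed probabilities that, up to time \<open>t\<close>, the
  coordinates in each block of \<open>Q\<close> stay in $(0,1/2)$ and in order; by independence this is the
  Pfaffian expression. Up to the exit time \<open>T\<close> of the alcove all these events hold. At time \<open>T\<close>
  either some coordinate is $0$ or $1/2$, and then all of them fail, or two neighbouring coordinates
  agree; exchanging these two preserves the law of the future but reverses the sign of every \<open>Q\<close>
  not pairing them, while the event of a \<open>Q\<close> that does pair them fails. By the strong Markov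
  property only the paths with \<open>T > t\<close> contribute, and the signs sum to 1, by the same
  sign-reversing exchange.\<close>

section \<open>Signed sums over matchings\<close>

text \<open>Two obstacles shape the proof. First, an exchange of two indices must reverse the sign
  of a whole matching, and this is arranged by exchanging neighbours only: replacing an index by its
  successor and vice versa alters the order of no other pair, so crossings can change only between
  the two blocks that contain them. The closed alcove supplies such neighbours: its coordinates
  decrease weakly, so an equality of any two coordinates forces an equality of two successive ones.
  Second, paths are continuous only almost surely, the sigma-algebra of path space sees only
  countably many times at once, and the strong Markov property is given for the raw filtration, for
  which the exit time of an open set need not be a stopping time. Survival events and the exit time
  are therefore replaced by versions built from rational times (\<open>stays\<close>,
  \<open>hitting_time\<close>), which make sense for every path and agree with the originals on
  continuous paths starting in the alcove. This almost sure agreement is turned into equality of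
  probabilities in the completion.\<close>

abbreviation transp :: "'a \<Rightarrow> 'a \<Rightarrow> 'a \<Rightarrow> 'a" where
  "transp \<equiv> Transposition.transpose"

definition cross :: "'a::linorder set \<Rightarrow> 'a set \<Rightarrow> bool" where
  "cross b c \<longleftrightarrow> Min b < Min c \<and> Min c < Max b \<and> Max b < Max c"

text \<open>Allowing at most one singleton treats both parities of k at once: on a finite index set,
  parity excludes the singleton when the number of indices is even and forces it when that number is
  odd.\<close>

definition matchings :: "'a set \<Rightarrow> 'a set set set" where
  "matchings I = {Q. partition_on I Q \<and> (\<forall>b\<in>Q. card b = 1 \<or> card b = 2) \<and>
     (\<forall>l m. {l} \<in> Q \<longrightarrow> {m} \<in> Q \<longrightarrow> l = m)}"

text \<open>For odd $k$ the index $l$ outside the Pfaffian becomes a singleton block \<open>{l}\<close>; the second summand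
  is then the exponent $l-1$.\<close>

definition matching_sign :: "'a::linorder set \<Rightarrow> 'a set set \<Rightarrow> real" where
  "matching_sign I Q = (-1) ^ (crossings Q + card {i\<in>I. \<exists>l. {l} \<in> Q \<and> i < l})"

section \<open>Crossings under order-preserving maps and under exchange of neighbours\<close>

lemma crossings_eq_sum:
  assumes "finite Q"
  shows "crossings Q = (\<Sum>(b, c)\<in>Q \<times> Q. of_bool (cross b c))"
proof -
  have "crossings Q = card ((Q \<times> Q) \<inter> {(b, c). cross b c})"
    unfolding crossings_def cross_def by (intro arg_cong[where f=card]) auto
  also have "\<dots> = (\<Sum>z\<in>Q \<times> Q. of_bool (z \<in> {(b, c). cross b c}))"
    using assms by (simp add: Int_def)
  finally show ?thesis by (simp add: case_prod_beta)
qed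

lemma Min_image_strict_mono_on:
  assumes "strict_mono_on b f" "finite b" "b \<noteq> {}"
  shows "Min (f ` b) = f (Min b)" and "Max (f ` b) = f (Max b)"
proof -
  have le: "f c \<le> f d" if "c \<in> b" "d \<in> b" "c \<le> d" for c d
    using assms(1) that by (metis order_le_less strict_mono_onD)
  show "Min (f ` b) = f (Min b)"
    using assms(2,3) by (intro Min_eqI) (auto intro!: le Min_in)
  show "Max (f ` b) = f (Max b)"
    using assms(2,3) by (intro Max_eqI) (auto intro!: le Max_in)
qed

lemma cross_image_strict_mono_on:
  assumes mono: "strict_mono_on (b \<union> c) f" and "finite b" "b \<noteq> {}" "finite c" "c \<noteq> {}"
  shows "cross (f ` b) (f ` c) \<longleftrightarrow> cross b c"
proof -
  have "strict_mono_on b f" "strict_mono_on c f"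
    using mono by (auto simp: monotone_on_def)
  moreover have less: "f x < f y \<longleftrightarrow> x < y" if "x \<in> b \<union> c" "y \<in> b \<union> c" for x y
    using mono that by (metis linorder_neqE order_less_asym strict_mono_onD)
  have "Min b \<in> b \<union> c" "Max b \<in> b \<union> c" "Min c \<in> b \<union> c" "Max c \<in> b \<union> c"
    using assms(2-5) by auto
  note less[OF this(1,3)] less[OF this(3,2)] less[OF this(2,4)]
  ultimately show ?thesis
    unfolding cross_def using assms(2-5) by (simp add: Min_image_strict_mono_on)
qed

text \<open>Exchanging neighbours disturbs the order of the pair \<open>a\<close>, \<open>b\<close>
  only, so it is increasing on every set that misses one of the two.\<close>

lemma strict_mono_on_transpose_adjacent:
  fixes a b :: "'a::linorder"
  assumes "a < b" "\<forall>c\<in>S. c \<le> a \<or> b \<le> c" "a \<notin> S \<or> b \<notin> S"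
  shows "strict_mono_on S (transp a b)"
proof (rule strict_mono_onI)
  fix r s assume "r \<in> S" "s \<in> S" "r < s"
  then show "transp a b r < transp a b s"
    using assms(1,3) assms(2)[rule_format, of r] assms(2)[rule_format, of s] by (auto simp: Transposition.transpose_def)
qed

lemma cross_singleton [simp]: "\<not> cross {l} c" "\<not> cross b {l}"
  by (auto simp: cross_def)

lemma cross_doubleton:
  assumes "x < y" "u < v"
  shows "cross {x, y} {u, v} \<longleftrightarrow> x < u \<and> u < y \<and> y < v"
  using assms by (simp add: cross_def)

text \<open>Of the two ways to join the neighbours \<open>a\<close>, \<open>b\<close> to the outside
  points \<open>j\<close>, \<open>m\<close>, exactly one crosses. Four terms occur because
  \<open>cross\<close> is not symmetric and counts a crossing in one order only.\<close>

lemma cross_doubleton_swap: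
  fixes a b j m :: "'a::linorder"
  assumes "a < b" "j < a \<or> b < j" "m < a \<or> b < m" "j \<noteq> m"
  shows "of_bool (cross {a, j} {b, m}) + of_bool (cross {b, m} {a, j}) +
    of_bool (cross {b, j} {a, m}) + of_bool (cross {a, m} {b, j}) = (1::nat)"
proof -
  consider "j < a" "m < a" "j < m" | "j < a" "m < a" "m < j" | "j < a" "b < m"
    | "b < j" "m < a" | "b < j" "b < m" "j < m" | "b < j" "b < m" "m < j"
    using assms by fastforce
  moreover have lt: "x < a \<Longrightarrow> x < b" "b < x \<Longrightarrow> a < x" for x
    using assms(1) by auto
  ultimately show ?thesis
  proof cases
    case 1
    then show ?thesis
      using assms(1) cross_doubleton[of j a m b] cross_doubleton[of m b j a]
        cross_doubleton[of j b m a] cross_doubleton[of m a j b] lt[of j] lt[of m]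
      by (auto simp: insert_commute)
  next
    case 2
    then show ?thesis
      using assms(1) cross_doubleton[of j a m b] cross_doubleton[of m b j a]
        cross_doubleton[of j b m a] cross_doubleton[of m a j b] lt[of j] lt[of m]
      by (auto simp: insert_commute)
  next
    case 3
    then show ?thesis
      using assms(1) cross_doubleton[of j a b m] cross_doubleton[of b m j a]
        cross_doubleton[of j b a m] cross_doubleton[of a m j b] lt[of j] lt[of m]
      by (auto simp: insert_commute)
  next
    case 4
    then show ?thesis
      using assms(1) cross_doubleton[of a j m b] cross_doubleton[of m b a j]
        cross_doubleton[of b j m a] cross_doubleton[of m a b j] lt[of j] lt[of m]
      by (auto simp: insert_commute)
  next
    case 5
    then show ?thesis
      using assms(1) cross_doubleton[of a j b m] cross_doubleton[of b m a j]
        cross_doubleton[of b j a m] cross_doubleton[of a m b j] lt[of j] lt[of m] by auto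
  next
    case 6
    then show ?thesis
      using assms(1) cross_doubleton[of a j b m] cross_doubleton[of b m a j]
        cross_doubleton[of b j a m] cross_doubleton[of a m b j] lt[of j] lt[of m] by auto
  qed
qed

section \<open>Matchings and their signs under exchange of neighbours\<close>

lemma finite_matching: "finite I \<Longrightarrow> Q \<in> matchings I \<Longrightarrow> finite Q"
  by (auto simp: matchings_def intro: finite_elements)

lemma finite_matchings: "finite I \<Longrightarrow> finite (matchings I)"
  by (rule finite_subset[of _ "Pow (Pow I)"]) (auto simp: matchings_def partition_on_def)

lemma matching_block:
  assumes "Q \<in> matchings I" "B \<in> Q" "a \<in> B"
  obtains "B = {a}" | j where "B = {a, j}" "j \<noteq> a" "j \<in> I"
proof -
  have "card B = 1 \<or> card B = 2" "B \<subseteq> I"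
    using assms by (auto simp: matchings_def partition_on_def)
  then show ?thesis
    using assms(3) that by (auto simp: card_1_singleton_iff card_2_iff)
qed

lemma matching_block_unique:
  assumes "Q \<in> matchings I" "B \<in> Q" "C \<in> Q" "a \<in> B" "a \<in> C"
  shows "B = C"
proof -
  have "disjoint Q" using assms(1) by (simp add: matchings_def partition_on_def)
  from disjointD[OF this assms(2,3)] show ?thesis using assms(4,5) by blast
qed

lemma singleton_mem_image_transpose:
  "{l} \<in> image (transp a b) ` Q \<longleftrightarrow> {transp a b l} \<in> Q"
proof
  assume "{l} \<in> image (transp a b) ` Q"
  then obtain B where B: "B \<in> Q" "{l} = transp a b ` B" by auto
  have "transp a b ` {l} = B"
    unfolding B(2) image_image by simp
  then show "{transp a b l} \<in> Q" using B(1) by simp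
next
  assume "{transp a b l} \<in> Q"
  moreover have "{l} = transp a b ` {transp a b l}" by simp
  ultimately show "{l} \<in> image (transp a b) ` Q" by blast
qed

lemma image_transpose_matchings:
  assumes "Q \<in> matchings I" "a \<in> I" "b \<in> I"
  shows "image (transp a b) ` Q \<in> matchings I"
proof -
  let ?t = "transp a b"
  have "?t ` I = I"
    using assms(2,3) by (simp add: transpose_image_eq)
  moreover have "partition_on (?t ` I) (image ?t ` Q - {{}})"
    using assms(1) by (intro partition_on_inj_image inj_on_transpose) (simp add: matchings_def)
  moreover have "image ?t ` Q - {{}} = image ?t ` Q"
    using assms(1) by (auto simp: matchings_def partition_on_def)
  ultimately have "partition_on I (image ?t ` Q)" by simp
  moreover have "\<forall>c\<in>Q. card (?t ` c) = 1 \<or> card (?t ` c) = 2"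
    using assms(1) by (simp add: matchings_def card_image)
  moreover have "l = m" if "{l} \<in> image ?t ` Q" "{m} \<in> image ?t ` Q" for l m
  proof -
    have "?t l = ?t m"
      using assms(1) that by (simp add: matchings_def singleton_mem_image_transpose)
    then show ?thesis by (rule injD[OF inj_transpose])
  qed
  ultimately show ?thesis
    unfolding matchings_def by blast
qed

lemma card_below_singleton:
  assumes "Q \<in> matchings I" "{l} \<in> Q"
  shows "{i\<in>I. \<exists>l. {l} \<in> Q \<and> i < l} = {i\<in>I. i < l}"
  using assms by (auto simp: matchings_def)

text \<open>Pairs of blocks whose union misses \<open>a\<close> or \<open>b\<close> keep their
  crossings, as the exchange is increasing there. What remains is the block of \<open>a\<close>
  against the block of \<open>b\<close>: if both are doubletons, exactly one of \<open>Q\<close> and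
  its image has a crossing there; a singleton crosses nothing.\<close>

lemma crossings_image_transpose:
  fixes a b :: "'a::linorder"
  assumes I: "finite I" and Q: "Q \<in> matchings I" and ab: "a \<in> I" "b \<in> I" "a < b"
    and adj: "\<forall>c\<in>I. c \<le> a \<or> b \<le> c" and "{a, b} \<notin> Q"
  shows "odd (crossings Q + crossings (image (transp a b) ` Q)) \<longleftrightarrow> {a} \<notin> Q \<and> {b} \<notin> Q"
proof -
  let ?t = "transp a b"
  have fin: "finite Q" using I Q by (rule finite_matching)
  have part: "partition_on I Q" using Q by (simp add: matchings_def)
  obtain B where B: "B \<in> Q" "a \<in> B" using part ab by (auto simp: partition_on_def)
  obtain C where C: "C \<in> Q" "b \<in> C" using part ab by (auto simp: partition_on_def)
  have "B \<noteq> C"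
  proof
    assume "B = C"
    then show False
      using matching_block[OF Q B] B C ab \<open>{a, b} \<notin> Q\<close> by auto
  qed
  then have notin: "b \<notin> B" "a \<notin> C"
    using matching_block_unique[OF Q] B C by blast+
  \<comment> \<open>The only ordered pairs of blocks whose union contains both \<open>a\<close> and
    \<open>b\<close>.\<close>
  let ?E = "{(B, C), (C, B)}"
  define S where "S = (\<Sum>(c, d)\<in>Q \<times> Q - ?E. of_bool (cross c d) :: nat)"
  have inj: "inj_on (image ?t) Q"
    by (meson inj_image_eq_iff inj_onI inj_transpose)
  have split: "(\<Sum>z\<in>Q \<times> Q. g z) = (\<Sum>z\<in>Q \<times> Q - ?E. g z) + (g (B, C) + g (C, B))" for g :: "_ \<Rightarrow> nat"
    using fin B C \<open>B \<noteq> C\<close> by (subst sum.subset_diff[of ?E]) auto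
  have cr: "crossings Q = S + (of_bool (cross B C) + of_bool (cross C B))"
    unfolding crossings_eq_sum[OF fin] S_def by (subst split) simp
  have "bij_betw (map_prod (image ?t) (image ?t)) (Q \<times> Q) (image ?t ` Q \<times> image ?t ` Q)"
    using inj by (simp add: bij_betw_def map_prod_inj_on map_prod_surj_on)
  from sum.reindex_bij_betw[OF this, of "\<lambda>(c, d). of_bool (cross c d) :: nat"]
  have "crossings (image ?t ` Q) = (\<Sum>(c, d)\<in>Q \<times> Q. of_bool (cross (?t ` c) (?t ` d)))"
    using fin by (simp add: crossings_eq_sum case_prod_beta)
  also have "\<dots> = (\<Sum>(c, d)\<in>Q \<times> Q - ?E. of_bool (cross (?t ` c) (?t ` d))) +
      (of_bool (cross (?t ` B) (?t ` C)) + of_bool (cross (?t ` C) (?t ` B)))"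
    by (subst split) simp
  also have "(\<Sum>(c, d)\<in>Q \<times> Q - ?E. of_bool (cross (?t ` c) (?t ` d))) = S"
    unfolding S_def
  proof (rule sum.cong[OF refl])
    fix z assume "z \<in> Q \<times> Q - ?E"
    then obtain c d where z: "z = (c, d)" and cd: "c \<in> Q" "d \<in> Q" "(c, d) \<notin> ?E"
      by (cases z) auto
    have sub: "c \<subseteq> I" "d \<subseteq> I" "c \<noteq> {}" "d \<noteq> {}"
      using cd part by (auto simp: partition_on_def)
    have "a \<notin> c \<union> d \<or> b \<notin> c \<union> d"
    proof (rule ccontr)
      assume "\<not> (a \<notin> c \<union> d \<or> b \<notin> c \<union> d)"
      then have "(c = B \<or> d = B) \<and> (c = C \<or> d = C)"
        using matching_block_unique[OF Q] B C cd by blast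
      then show False using cd \<open>B \<noteq> C\<close> by auto
    qed
    then have "strict_mono_on (c \<union> d) ?t"
      using sub adj ab by (intro strict_mono_on_transpose_adjacent) auto
    then have "cross (?t ` c) (?t ` d) = cross c d"
      using sub I by (intro cross_image_strict_mono_on) (auto intro: finite_subset)
    then show "(case z of (c, d) \<Rightarrow> of_bool (cross (?t ` c) (?t ` d))) =
        (case z of (c, d) \<Rightarrow> of_bool (cross c d))"
      by (simp add: z)
  qed
  finally have cr_t: "crossings (image ?t ` Q) =
      S + (of_bool (cross (?t ` B) (?t ` C)) + of_bool (cross (?t ` C) (?t ` B)))" .
  have "{a} \<in> Q \<longleftrightarrow> B = {a}" "{b} \<in> Q \<longleftrightarrow> C = {b}"
    using matching_block_unique[OF Q] B C by auto
  then show ?thesis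
  proof (cases rule: matching_block[OF Q B])
    case 1
    then show ?thesis
      using cr cr_t \<open>{a} \<in> Q \<longleftrightarrow> B = {a}\<close> by simp
  next
    case (2 j)
    note Bj = this
    show ?thesis
    proof (cases rule: matching_block[OF Q C])
      case 1
      then show ?thesis
        using cr cr_t \<open>{b} \<in> Q \<longleftrightarrow> C = {b}\<close> by simp
    next
      case (2 m)
      have "j \<noteq> m"
        using matching_block_unique[OF Q, of B C j] B C Bj 2 \<open>B \<noteq> C\<close> by auto
      moreover have "j \<noteq> b" "m \<noteq> a" using notin Bj 2 by auto
      moreover from this have "j < a \<or> b < j" "m < a \<or> b < m"
        using adj Bj 2 by fastforce+
      ultimately have "of_bool (cross B C) + of_bool (cross C B) +
          (of_bool (cross (?t ` B) (?t ` C)) + of_bool (cross (?t ` C) (?t ` B))) = (1::nat)"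
        using cross_doubleton_swap[of a b j m] ab Bj 2 by (simp add: add_ac)
      then have "crossings Q + crossings (image ?t ` Q) = 2 * S + 1"
        using cr cr_t by simp
      moreover have "{a} \<notin> Q" "{b} \<notin> Q"
        using \<open>{a} \<in> Q \<longleftrightarrow> B = {a}\<close> \<open>{b} \<in> Q \<longleftrightarrow> C = {b}\<close> Bj 2 by auto
      ultimately show ?thesis by simp
    qed
  qed
qed

lemma card_below_adjacent:
  fixes a b :: "'a::linorder"
  assumes "finite I" "a \<in> I" "a < b" "\<forall>c\<in>I. c \<le> a \<or> b \<le> c"
  shows "card {i\<in>I. i < b} = Suc (card {i\<in>I. i < a})"
proof -
  have "{i\<in>I. i < b} = insert a {i\<in>I. i < a}"
    using assms(2-4) by force
  then show ?thesis using assms(1) by simp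
qed

text \<open>Exactly one of the two exponents changes parity. If neither \<open>a\<close> nor
  \<open>b\<close> is the singleton, it is the crossing number; if one of them is, the crossings
  keep their parity, but the singleton moves to the neighbouring index, which changes the number of
  indices below it by one.\<close>

lemma matching_sign_image_transpose:
  fixes a b :: "'a::linorder"
  assumes I: "finite I" and Q: "Q \<in> matchings I" and ab: "a \<in> I" "b \<in> I" "a < b"
    and adj: "\<forall>c\<in>I. c \<le> a \<or> b \<le> c" and notin: "{a, b} \<notin> Q"
  shows "matching_sign I (image (transp a b) ` Q) = - matching_sign I Q"
proof -
  let ?t = "transp a b"
  let ?s = "\<lambda>Q. card {i\<in>I. \<exists>l. {l} \<in> Q \<and> i < l}"
  have tQ: "image ?t ` Q \<in> matchings I"
    using Q ab by (intro image_transpose_matchings)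
  have "odd (?s Q + ?s (image ?t ` Q)) \<longleftrightarrow> {a} \<in> Q \<or> {b} \<in> Q"
  proof (cases "{a} \<in> Q \<or> {b} \<in> Q")
    case True
    then show ?thesis
    proof
      assume "{a} \<in> Q"
      then have "{b} \<in> image ?t ` Q" by (simp add: singleton_mem_image_transpose)
      then show ?thesis
        using card_below_singleton[OF Q \<open>{a} \<in> Q\<close>] card_below_singleton[OF tQ]
          card_below_adjacent[OF I ab(1,3) adj] \<open>{a} \<in> Q\<close> by simp
    next
      assume "{b} \<in> Q"
      then have "{a} \<in> image ?t ` Q" by (simp add: singleton_mem_image_transpose)
      then show ?thesis
        using card_below_singleton[OF Q \<open>{b} \<in> Q\<close>] card_below_singleton[OF tQ]
          card_below_adjacent[OF I ab(1,3) adj] \<open>{b} \<in> Q\<close> by simp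
    qed
  next
    case False
    have "{l} \<in> image ?t ` Q \<longleftrightarrow> {l} \<in> Q" for l
      using False by (cases "l = a \<or> l = b") (auto simp: singleton_mem_image_transpose)
    then show ?thesis using False by simp
  qed
  then have "odd ((crossings Q + ?s Q) + (crossings (image ?t ` Q) + ?s (image ?t ` Q)))"
    using crossings_image_transpose[OF I Q ab adj notin] by auto
  then show ?thesis
    unfolding matching_sign_def by (auto simp: minus_one_power_iff)
qed

text \<open>The exchange is an involution on matchings that keeps the weight and reverses the sign,
  except on matchings containing the block \<open>{a, b}\<close>, where the weight vanishes. It is
  applied to survival probabilities at a wall of the alcove and to an indicator weight in
  \<open>sum_matching_sign\<close>.\<close>

lemma sum_matching_sign_swap_eq_0:
  fixes a b :: "'a::linorder" and w :: "'a set set \<Rightarrow> real"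
  assumes I: "finite I" and ab: "a \<in> I" "b \<in> I" "a < b"
    and adj: "\<forall>c\<in>I. c \<le> a \<or> b \<le> c"
    and inv: "\<And>Q. Q \<in> matchings I \<Longrightarrow> w (image (transp a b) ` Q) = w Q"
    and zero: "\<And>Q. Q \<in> matchings I \<Longrightarrow> {a, b} \<in> Q \<Longrightarrow> w Q = 0"
  shows "(\<Sum>Q\<in>matchings I. matching_sign I Q * w Q) = 0"
proof -
  let ?t = "\<lambda>Q. image (transp a b) ` Q"
  have invol: "?t (?t Q) = Q" for Q by (simp add: image_image)
  have "bij_betw ?t (matchings I) (matchings I)"
    by (rule bij_betw_byWitness[where f'="?t"])
      (use invol image_transpose_matchings ab in auto)
  then have "(\<Sum>Q\<in>matchings I. matching_sign I Q * w Q) =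
      (\<Sum>Q\<in>matchings I. matching_sign I (?t Q) * w (?t Q))"
    by (simp add: sum.reindex_bij_betw[where g="\<lambda>Q. matching_sign I Q * w Q"])
  also have "\<dots> = (\<Sum>Q\<in>matchings I. - (matching_sign I Q * w Q))"
  proof (rule sum.cong[OF refl])
    fix Q assume "Q \<in> matchings I"
    then show "matching_sign I (?t Q) * w (?t Q) = - (matching_sign I Q * w Q)"
      using zero inv matching_sign_image_transpose[OF I _ ab adj]
      by (cases "{a, b} \<in> Q") simp_all
  qed
  finally show ?thesis by (simp add: sum_negf)
qed

section \<open>The signs of all matchings sum to 1\<close>

lemma matchings_remove_block:
  assumes "Q \<in> matchings I" "B \<in> Q"
  shows "Q - {B} \<in> matchings (I - B)"
proof -
  have "disjoint Q" and un: "\<Union>Q = I" and "{} \<notin> Q"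
    using assms(1) by (auto simp: matchings_def partition_on_def)
  then have "\<Union>(Q - {B}) = I - B"
    using assms(2) by (fastforce dest: disjointD)
  then show ?thesis
    using assms(1) unfolding matchings_def partition_on_def
    by (auto intro: pairwise_subset[where S=Q])
qed

lemma matchings_insert_doubleton:
  assumes "Q \<in> matchings (I - {a, b})" "a \<in> I" "b \<in> I" "a \<noteq> b"
  shows "insert {a, b} Q \<in> matchings I"
proof -
  have "disjoint Q" and un: "\<Union>Q = I - {a, b}" and "{} \<notin> Q"
    using assms(1) by (auto simp: matchings_def partition_on_def)
  then have "partition_on I (insert {a, b} Q)"
    using assms(2-4) unfolding partition_on_def pairwise_insert disjnt_def by blast
  moreover have "{l} \<noteq> {a, b}" for l using assms(4) by auto
  ultimately show ?thesis
    using assms(1,4) unfolding matchings_def by simp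
qed

text \<open>A block made of the two least indices lies to the left of all others, hence crosses
  none, and adds either zero or two indices below the singleton.\<close>

lemma matching_sign_insert_least:
  fixes a b :: "'a::linorder"
  assumes I: "finite I" and Q: "Q \<in> matchings (I - {a, b})" and ab: "a \<in> I" "b \<in> I" "a < b"
    and least: "\<forall>c\<in>I - {a, b}. b < c"
  shows "matching_sign I (insert {a, b} Q) = matching_sign (I - {a, b}) Q"
proof -
  have ncr: "\<not> cross {a, b} c" "\<not> cross c {a, b}" if "c \<in> insert {a, b} Q" for c
  proof -
    have "c = {a, b} \<or> (finite c \<and> c \<noteq> {} \<and> (\<forall>x\<in>c. b < x))"
      using that Q I least by (auto simp: matchings_def partition_on_def intro: finite_subset)
    then have "c = {a, b} \<or> (b < Min c \<and> b < Max c)"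
      by (metis Max_in Min_in)
    then show "\<not> cross {a, b} c" "\<not> cross c {a, b}"
      using ab(3) by (auto simp: cross_def)
  qed
  have "{(b', c). b' \<in> insert {a, b} Q \<and> c \<in> insert {a, b} Q \<and> cross b' c} =
      {(b', c). b' \<in> Q \<and> c \<in> Q \<and> cross b' c}"
    using ncr by blast
  then have "crossings (insert {a, b} Q) = crossings Q"
    unfolding crossings_def cross_def[symmetric] by simp
  moreover have "even (card {i\<in>I. \<exists>l. {l} \<in> insert {a, b} Q \<and> i < l}) \<longleftrightarrow>
      even (card {i\<in>I - {a, b}. \<exists>l. {l} \<in> Q \<and> i < l})"
  proof -
    have sing: "{l} \<in> insert {a, b} Q \<longleftrightarrow> {l} \<in> Q" for l using ab(3) by auto
    show ?thesis
    proof (cases "\<exists>l. {l} \<in> Q")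
      case True
      then obtain l where l: "{l} \<in> Q" by auto
      then have "l \<in> I - {a, b}" using Q by (auto simp: matchings_def partition_on_def)
      then have "b < l" using least by auto
      then have "{i\<in>I. \<exists>l. {l} \<in> insert {a, b} Q \<and> i < l} =
          insert a (insert b {i\<in>I - {a, b}. \<exists>l. {l} \<in> Q \<and> i < l})"
        using l ab sing by auto
      then show ?thesis using I ab(3) by simp
    next
      case False
      have "a \<noteq> b" using ab(3) by simp
      then show ?thesis using False by auto
    qed
  qed
  ultimately show ?thesis
    unfolding matching_sign_def by (simp add: minus_one_power_iff)
qed

text \<open>For an even number of indices this says that the Pfaffian with all entries 1 above the
  diagonal is 1. With \<open>a\<close>, \<open>b\<close> the two least indices, the matchings
  without the block \<open>{a, b}\<close> cancel by the exchange; those with it correspond, with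
  equal signs, to the matchings of the remaining indices, and induction applies.\<close>

lemma sum_matching_sign:
  fixes I :: "'a::linorder set"
  assumes "finite I"
  shows "(\<Sum>Q\<in>matchings I. matching_sign I Q) = 1"
  using assms
proof (induction "card I" arbitrary: I rule: less_induct)
  case less
  consider "I = {}" | l where "I = {l}" | "card I \<ge> 2"
    using less.prems by (metis One_nat_def card_1_singletonE card_0_eq less_2_cases not_less)
  then show ?case
  proof cases
    case 1
    then have "matchings I = {{}}"
      by (auto simp: matchings_def partition_on_empty)
    then show ?thesis
      using 1 by (simp add: matching_sign_def crossings_def)
  next
    case (2 l)
    have "partition_on {l} Q \<longleftrightarrow> Q = {{l}}" for Q
    proof
      assume Q: "partition_on {l} Q"
      have "b = {l}" if "b \<in> Q" for b
        using Q that by (metis Union_upper partition_on_def subset_singletonD)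
      then have "Q \<subseteq> {{l}}" by auto
      then show "Q = {{l}}" using Q by (auto simp: partition_on_def subset_singleton_iff)
    qed (simp add: partition_on_def)
    then have "matchings I = {{{l}}}"
      using 2 by (auto simp: matchings_def)
    moreover have "crossings {{l}} = 0"
      by (simp add: crossings_eq_sum)
    ultimately show ?thesis
      using 2 by (simp add: matching_sign_def conj_commute cong: conj_cong)
  next
    case 3
    define a where "a = Min I"
    define b where "b = Min (I - {a})"
    have "I \<noteq> {}" using 3 by auto
    then have a: "a \<in> I" "\<forall>c\<in>I. a \<le> c" using less.prems by (auto simp: a_def)
    then have "card (I - {a}) \<noteq> 0" using 3 less.prems by simp
    then have "I - {a} \<noteq> {}" by (metis card.empty)
    then have b: "b \<in> I - {a}" "\<forall>c\<in>I - {a}. b \<le> c" using less.prems unfolding b_def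
      by (meson Min_in Min_le finite_Diff)+
    have ab: "a < b" using a b by (auto simp: order.strict_iff_order)
    have least: "\<forall>c\<in>I - {a, b}. b < c" using b by (auto simp: order.strict_iff_order)
    have fin: "finite (matchings I)" using less.prems by (rule finite_matchings)
    \<comment> \<open>The weight vanishes on matchings containing \<open>{a, b}\<close> and is
      unchanged by the exchange, since the exchange maps the set \<open>{a, b}\<close> to
      itself.\<close>
    have "(\<Sum>Q\<in>matchings I. matching_sign I Q * of_bool ({a, b} \<notin> Q)) = 0"
    proof (rule sum_matching_sign_swap_eq_0[OF less.prems])
      fix Q :: "'a set set"
      have "{a, b} \<in> image (transp a b) ` Q \<longleftrightarrow> {a, b} \<in> Q"
      proof -
        have "transp a b ` {a, b} = {a, b}" by auto
        then have "{a, b} \<in> image (transp a b) ` Q \<longleftrightarrow>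
            transp a b ` {a, b} \<in> image (transp a b) ` Q" by simp
        also have "\<dots> \<longleftrightarrow> {a, b} \<in> Q"
          by (intro inj_image_mem_iff) (simp add: inj_image_eq_iff[OF inj_transpose] inj_def)
        finally show ?thesis .
      qed
      then show "of_bool ({a, b} \<notin> image (transp a b) ` Q) = (of_bool ({a, b} \<notin> Q) :: real)"
        by simp
    qed (use a b ab in auto)
    then have "(\<Sum>Q\<in>matchings I. matching_sign I Q) =
        (\<Sum>Q\<in>matchings I. matching_sign I Q * of_bool ({a, b} \<in> Q))"
      by (subst (asm) of_bool_not_iff) (simp add: algebra_simps sum_subtractf)
    also have "\<dots> = (\<Sum>Q\<in>{Q\<in>matchings I. {a, b} \<in> Q}. matching_sign I Q)"
      using fin by (simp add: sum.inter_filter of_bool_def if_distrib cong: if_cong)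
    also have "\<dots> = (\<Sum>Q\<in>matchings (I - {a, b}). matching_sign I (insert {a, b} Q))"
    proof (rule sum.reindex_bij_witness[where j="\<lambda>Q. Q - {{a, b}}" and i="insert {a, b}"])
      fix Q assume "Q \<in> matchings (I - {a, b})"
      then show "insert {a, b} Q - {{a, b}} = Q"
        by (auto simp: matchings_def partition_on_def)
    qed (use matchings_remove_block[of _ I "{a, b}"] matchings_insert_doubleton[of _ I a b] a b ab
      in \<open>auto simp: insert_absorb\<close>)
    also have "\<dots> = (\<Sum>Q\<in>matchings (I - {a, b}). matching_sign (I - {a, b}) Q)"
      using matching_sign_insert_least[OF less.prems] a b ab least by (intro sum.cong) auto
    also have "\<dots> = 1"
      using a b less.prems by (intro less.hyps) (auto intro!: psubset_card_mono)
    finally show ?thesis .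
  qed
qed

section \<open>From matchings to Pfaffians\<close>

lemma even_card_pairings:
  assumes "finite I" "Q \<in> pairings I"
  shows "even (card I)"
proof -
  have Q: "\<Union>Q = I" "disjoint Q" "\<forall>b\<in>Q. card b = 2"
    using assms(2) by (auto simp: pairings_def partition_on_def)
  then have "card (\<Union>Q) = sum card Q"
    using assms(1) by (intro card_Union_disjoint) (auto intro: finite_subset)
  also have "\<dots> = (\<Sum>b\<in>Q. 2)"
    using Q(3) by (intro sum.cong) auto
  finally show ?thesis using Q(1) by simp
qed

lemma matching_remove_singleton:
  assumes "Q \<in> matchings I" "{l} \<in> Q"
  shows "Q - {{l}} \<in> pairings (I - {l})"
proof -
  have "card b = 2" if "b \<in> Q - {{l}}" for b
  proof -
    have "card b = 1 \<or> card b = 2" "\<forall>m. {m} \<in> Q \<longrightarrow> l = m"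
      using assms that by (auto simp: matchings_def)
    then show ?thesis using that by (auto simp: card_1_singleton_iff)
  qed
  then show ?thesis
    using matchings_remove_block[OF assms] by (simp add: pairings_def matchings_def)
qed

lemma pairings_subset_matchings: "pairings I \<subseteq> matchings I"
  by (auto simp: pairings_def matchings_def)

lemma matching_no_singleton:
  assumes "Q \<in> matchings I" "\<And>l. {l} \<notin> Q"
  shows "Q \<in> pairings I"
  using assms unfolding pairings_def matchings_def by (auto simp: card_1_singleton_iff)

lemma matchings_even:
  assumes "finite I" "even (card I)"
  shows "matchings I = pairings I"
proof
  show "matchings I \<subseteq> pairings I"
  proof
    fix Q assume Q: "Q \<in> matchings I"
    have "{l} \<notin> Q" for l
    proof
      assume l: "{l} \<in> Q"
      then have "l \<in> I" using Q by (auto simp: matchings_def partition_on_def)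
      have "even (card (I - {l}))"
        using even_card_pairings[OF _ matching_remove_singleton[OF Q l]] assms(1) by simp
      then show False
        using assms \<open>l \<in> I\<close> card_Suc_Diff1[OF assms(1) \<open>l \<in> I\<close>] by (metis even_Suc)
    qed
    then show "Q \<in> pairings I" using Q matching_no_singleton by blast
  qed
qed (rule pairings_subset_matchings)

lemma pairing_insert_singleton:
  assumes "Q \<in> pairings (I - {l})" "l \<in> I"
  shows "insert {l} Q \<in> matchings I" "{l} \<notin> Q"
proof -
  have Q: "\<Union>Q = I - {l}" "disjoint Q" "{} \<notin> Q" "\<forall>b\<in>Q. card b = 2"
    using assms(1) by (auto simp: pairings_def partition_on_def)
  then have "partition_on I (insert {l} Q)"
    using assms(2) unfolding partition_on_def pairwise_insert disjnt_def by blast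
  moreover have sing: "{m} \<notin> Q" for m
  proof
    assume "{m} \<in> Q"
    then have "card {m} = 2" using Q(4) by blast
    then show False by simp
  qed
  ultimately show "insert {l} Q \<in> matchings I"
    using Q(4) by (simp add: matchings_def)
  show "{l} \<notin> Q" by (rule sing)
qed

text \<open>With an odd number of indices every matching has a singleton, since otherwise it would
  be a pairing, and it has only one; so it is determined by that index and a pairing of the
  rest.\<close>

lemma sum_matchings_odd:
  fixes f :: "'a set set \<Rightarrow> real"
  assumes "finite I" "odd (card I)"
  shows "(\<Sum>Q\<in>matchings I. f Q) = (\<Sum>l\<in>I. \<Sum>Q\<in>pairings (I - {l}). f (insert {l} Q))"
proof -
  have fin: "finite (pairings (I - {l}))" for l
    using assms(1) by (intro finite_subset[OF pairings_subset_matchings] finite_matchings) simp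
  let ?the = "\<lambda>Q. THE l. {l} \<in> Q"
  have the: "?the Q = l" if "Q \<in> matchings I" "{l} \<in> Q" for Q l
    using that by (intro the_equality) (auto simp: matchings_def)
  have ex: "\<exists>l. {l} \<in> Q" if "Q \<in> matchings I" for Q
    using that matching_no_singleton even_card_pairings assms by metis
  have "(\<Sum>l\<in>I. \<Sum>Q\<in>pairings (I - {l}). f (insert {l} Q)) =
      (\<Sum>(l, Q)\<in>Sigma I (\<lambda>l. pairings (I - {l})). f (insert {l} Q))"
    using assms(1) fin by (intro sum.Sigma) auto
  also have "\<dots> = (\<Sum>Q\<in>matchings I. f Q)"
  proof (rule sum.reindex_bij_witness[where j="\<lambda>(l, Q). insert {l} Q"
        and i="\<lambda>Q. (?the Q, Q - {{?the Q}})"])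
    fix z assume "z \<in> Sigma I (\<lambda>l. pairings (I - {l}))"
    then obtain l Q where z: "z = (l, Q)" "l \<in> I" "Q \<in> pairings (I - {l})" by auto
    note pairing_insert_singleton[OF z(3,2)]
    moreover from this(1) have "?the (insert {l} Q) = l" by (rule the) simp
    ultimately show "(?the (case z of (l, Q) \<Rightarrow> insert {l} Q),
        (case z of (l, Q) \<Rightarrow> insert {l} Q) - {{?the (case z of (l, Q) \<Rightarrow> insert {l} Q)}}) = z"
      "(case z of (l, Q) \<Rightarrow> insert {l} Q) \<in> matchings I"
      using z(1) by auto
  next
    fix Q assume Q: "Q \<in> matchings I"
    then obtain l where l: "{l} \<in> Q" using ex by auto
    then have "l \<in> I" using Q by (auto simp: matchings_def partition_on_def)
    then show "(case (?the Q, Q - {{?the Q}}) of (l, Q) \<Rightarrow> insert {l} Q) = Q"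
      "(?the Q, Q - {{?the Q}}) \<in> Sigma I (\<lambda>l. pairings (I - {l}))"
      using the[OF Q l] matching_remove_singleton[OF Q l] l by (auto simp: insert_absorb)
  qed auto
  finally show ?thesis by simp
qed

lemma prod_pairing_eq:
  fixes p :: "'a::linorder set \<Rightarrow> real"
  assumes "Q \<in> pairings I" "\<And>i j. i < j \<Longrightarrow> a i j = p {i, j}"
  shows "(\<Prod>b\<in>Q. a (Min b) (Max b)) = (\<Prod>b\<in>Q. p b)"
proof (rule prod.cong[OF refl])
  fix b assume "b \<in> Q"
  then have "card b = 2" using assms(1) by (simp add: pairings_def)
  then obtain i j where "b = {i, j}" "i \<noteq> j" by (auto simp: card_2_iff)
  then obtain i j where b: "b = {i, j}" "i < j" by (metis insert_commute linorder_neqE)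
  then show "a (Min b) (Max b) = p b" using assms(2)[of i j] by simp
qed

text \<open>Weights attached to blocks, as independence produces them, become a Pfaffian of a
  matrix. In the odd case the singleton crosses nothing, so the sign splits into the crossing sign
  of the remaining pairing and the sign given by the position of \<open>l\<close>.\<close>

lemma sum_matchings_eq_pfaffian:
  fixes p :: "'a::linorder set \<Rightarrow> real"
  assumes I: "finite I" and a: "\<And>i j. i < j \<Longrightarrow> a i j = p {i, j}"
  shows "(\<Sum>Q\<in>matchings I. matching_sign I Q * (\<Prod>b\<in>Q. p b)) =
    (if even (card I) then pfaffian I a
     else \<Sum>l\<in>I. (-1) ^ card {i\<in>I. i < l} * p {l} * pfaffian (I - {l}) a)"
proof (cases "even (card I)")
  case True
  have "matching_sign I Q = (-1) ^ crossings Q" if "Q \<in> pairings I" for Q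
  proof -
    have "{l} \<notin> Q" for l using that by (force simp: pairings_def)
    then show ?thesis by (simp add: matching_sign_def)
  qed
  then show ?thesis
    using True I by (simp add: matchings_even pfaffian_def prod_pairing_eq[where a=a and p=p, OF _ a])
next
  case False
  have "(\<Sum>Q\<in>pairings (I - {l}). matching_sign I (insert {l} Q) * (\<Prod>b\<in>insert {l} Q. p b)) =
      (-1) ^ card {i\<in>I. i < l} * p {l} * pfaffian (I - {l}) a" if "l \<in> I" for l
    unfolding pfaffian_def sum_distrib_left
  proof (rule sum.cong[OF refl])
    fix Q assume Q: "Q \<in> pairings (I - {l})"
    note ins = pairing_insert_singleton[OF Q that]
    have "crossings (insert {l} Q) = crossings Q"
    proof -
      have "{(b, c). b \<in> insert {l} Q \<and> c \<in> insert {l} Q \<and> cross b c} =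
          {(b, c). b \<in> Q \<and> c \<in> Q \<and> cross b c}"
        by auto
      then show ?thesis unfolding crossings_def cross_def[symmetric] by simp
    qed
    moreover have "finite Q"
      using finite_matching[OF I ins(1)] by simp
    ultimately show "matching_sign I (insert {l} Q) * (\<Prod>b\<in>insert {l} Q. p b) =
        (-1) ^ card {i\<in>I. i < l} * p {l} * ((-1) ^ crossings Q * (\<Prod>b\<in>Q. a (Min b) (Max b)))"
      using ins card_below_singleton[OF ins(1), of l] prod_pairing_eq[where a=a and p=p, OF Q a]
      by (simp add: matching_sign_def power_add)
  qed
  then show ?thesis
    using False I by (simp add: sum_matchings_odd)
qed

section \<open>Survival events on path space\<close>

lemma continuous_ge_on_Rats:
  fixes g :: "real \<Rightarrow> real"
  assumes "continuous_on {0..} g" "\<forall>q\<in>\<rat> \<inter> {0..u}. c \<le> g q" "s \<in> {0..u}"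
  shows "c \<le> g s"
proof (cases "u = 0")
  case True
  then show ?thesis using assms by auto
next
  case False
  then have u: "0 < u" using assms(3) by auto
  \<comment> \<open>Density of the rationals is inherited by open sets, hence the open interval here
    and the separate case \<open>u = 0\<close>.\<close>
  have "closure ({0<..<u} \<inter> \<rat>) = closure {0<..<u}"
    by (intro closure_open_Int_superset) (auto simp: Rats_closure_real)
  then have cl: "closure ({0<..<u} \<inter> \<rat>) = {0..u}" using u by simp
  show ?thesis
  proof (rule continuous_ge_on_closure[where f=g])
    show "continuous_on (closure ({0<..<u} \<inter> \<rat>)) g"
      unfolding cl by (rule continuous_on_subset[OF assms(1)]) auto
    show "s \<in> closure ({0<..<u} \<inter> \<rat>)" using assms(3) cl by simp
    show "c \<le> g x" if "x \<in> {0<..<u} \<inter> \<rat>" for x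
      using assms(2) that by auto
  qed
qed

text \<open>A version of "the path remains in \<open>D\<close> during [0,u]" that is measurable on
  path space. Rational times alone could miss a contact with the boundary at an irrational time; a
  distance to the complement bounded below uniformly in time rules this out for continuous
  paths.\<close>

definition stays :: "'v::euclidean_space set \<Rightarrow> real \<Rightarrow> (real \<Rightarrow> 'v) set" where
  "stays D u = {p\<in>space path_space.
     \<exists>n. \<forall>q\<in>\<rat> \<inter> {0..u}. 1 / real (Suc n) \<le> infdist (p q) (- D)}"

lemma measurable_infdist_comp [measurable (raw)]:
  fixes f :: "'w \<Rightarrow> 'v::euclidean_space"
  assumes "f \<in> N \<rightarrow>\<^sub>M borel"
  shows "(\<lambda>\<omega>. infdist (f \<omega>) A) \<in> borel_measurable N"
  by (rule measurable_compose[OF assms]) (intro borel_measurable_continuous_onI continuous_intros)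

lemma measurable_path_space_component:
  "0 \<le> s \<Longrightarrow> (\<lambda>p. p s) \<in> path_space \<rightarrow>\<^sub>M borel"
  unfolding path_space_def by (rule measurable_component_singleton) simp

lemma stays_in_sets: "stays D u \<in> sets path_space"
proof -
  have "Measurable.pred path_space
      (\<lambda>p. \<exists>n. \<forall>q\<in>\<rat> \<inter> {0..u}. 1 / real (Suc n) \<le> infdist (p q) (- D))"
    by (intro pred_intros_countable measurable_pred_countable borel_measurable_le[folded pred_def]
        measurable_infdist_comp measurable_path_space_component)
      (auto intro: countable_Int1 countable_rat)
  then show ?thesis unfolding stays_def pred_def by simp
qed

text \<open>A continuous path in \<open>D\<close> has a positive minimal distance to the complement
  over the compact interval; conversely, a lower bound at rational times extends by density.
  \<open>D \<noteq> UNIV\<close> matters because \<open>infdist\<close> to the empty set is 0, so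
  that \<open>stays UNIV u\<close> is empty for \<open>u >= 0\<close>.\<close>

lemma mem_stays_iff:
  assumes p: "p \<in> space path_space" "continuous_on {0..} p"
    and D: "open D" "D \<noteq> UNIV" and u: "0 \<le> u"
  shows "p \<in> stays D u \<longleftrightarrow> (\<forall>s\<in>{0..u}. p s \<in> D)"
proof -
  let ?g = "\<lambda>s. infdist (p s) (- D)"
  have cont: "continuous_on {0..} ?g"
    using p(2) by (intro continuous_intros)
  show ?thesis
  proof
    assume "p \<in> stays D u"
    then obtain n where n: "\<forall>q\<in>\<rat> \<inter> {0..u}. 1 / real (Suc n) \<le> ?g q"
      by (auto simp: stays_def)
    show "\<forall>s\<in>{0..u}. p s \<in> D"
    proof
      fix s assume "s \<in> {0..u}"
      then have "1 / real (Suc n) \<le> ?g s" by (rule continuous_ge_on_Rats[OF cont n])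
      moreover have "0 < 1 / real (Suc n)" by simp
      ultimately have "?g s \<noteq> 0" by linarith
      then show "p s \<in> D" by (metis ComplI infdist_zero)
    qed
  next
    assume *: "\<forall>s\<in>{0..u}. p s \<in> D"
    have "\<exists>s\<in>{0..u}. \<forall>r\<in>{0..u}. ?g s \<le> ?g r"
      using u by (intro continuous_attains_inf continuous_on_subset[OF cont]) auto
    then obtain s where s: "s \<in> {0..u}" "\<forall>r\<in>{0..u}. ?g s \<le> ?g r" by auto
    have "0 < ?g s"
      using D s(1) * by (intro infdist_pos_not_in_closed) auto
    then obtain n where "1 / real (Suc n) < ?g s"
      using reals_Archimedean[of "?g s"] by (auto simp: inverse_eq_divide)
    then have "\<forall>q\<in>\<rat> \<inter> {0..u}. 1 / real (Suc n) \<le> ?g q"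
      using s(2) by fastforce
    then show "p \<in> stays D u" using p(1) unfolding stays_def by blast
  qed
qed

lemma path_in_space [simp]: "path X \<omega> \<in> space path_space"
  by (auto simp: path_def path_space_def space_PiM)

lemma path_apply [simp]: "0 \<le> s \<Longrightarrow> path X \<omega> s = X s \<omega>"
  by (simp add: path_def)

lemma continuous_on_path [simp]:
  "continuous_on {0..} (path X \<omega>) \<longleftrightarrow> continuous_on {0..} (\<lambda>t. X t \<omega>)"
  by (rule continuous_on_cong) simp_all

lemma path_mem_stays_iff:
  assumes "continuous_on {0..} (\<lambda>t. X t \<omega>)" "open D" "D \<noteq> UNIV" "0 \<le> u"
  shows "path X \<omega> \<in> stays D u \<longleftrightarrow> (\<forall>s\<in>{0..u}. X s \<omega> \<in> D)"
  using assms by (subst mem_stays_iff) auto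

lemma measurable_path:
  assumes "\<And>t. 0 \<le> t \<Longrightarrow> X t \<in> N \<rightarrow>\<^sub>M borel"
  shows "path X \<in> N \<rightarrow>\<^sub>M path_space"
  unfolding path_def path_space_def using assms by (intro measurable_restrict) auto

text \<open>Bridge from measurable events to literal ones: \<open>R\<close> may speak of uncountably
  many times and fail to be measurable, but is almost surely equivalent to the event
  \<open>A\<close>.\<close>

lemma completion_AE_eq:
  assumes "A \<in> sets N" "AE \<omega> in N. \<omega> \<in> A \<longleftrightarrow> R \<omega>"
  shows "{\<omega>\<in>space N. R \<omega>} \<in> sets (completion N)"
    and "measure (completion N) {\<omega>\<in>space N. R \<omega>} = measure N A"
proof -
  have ae: "AE \<omega> in completion N. \<omega> \<in> A \<longleftrightarrow> \<omega> \<in> {\<omega>\<in>space N. R \<omega>}"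
    using AE_completion[OF assms(2)] by (auto elim!: AE_mp)
  show *: "{\<omega>\<in>space N. R \<omega>} \<in> sets (completion N)"
    by (rule completion.in_sets_AE[OF _ sets_completionI_sets[OF assms(1)]]) (use ae in auto)
  have "measure (completion N) A = measure (completion N) {\<omega>\<in>space N. R \<omega>}"
    using * sets_completionI_sets[OF assms(1)] by (intro measure_eq_AE ae)
  then show "measure (completion N) {\<omega>\<in>space N. R \<omega>} = measure N A"
    using assms(1) by simp
qed

section \<open>Chambers\<close>

text \<open>One notion for all regions involved: singletons give the events of
  \<open>p_single\<close>, doubletons those of \<open>p_ordered\<close>, and the full index set
  gives the alcove.\<close>

definition chamber :: "'n set \<Rightarrow> (real^'n::{finite,linorder}) set" where
  "chamber b = {y. (\<forall>i\<in>b. 0 < y $ i \<and> y $ i < 1/2) \<and> (\<forall>i\<in>b. \<forall>j\<in>b. i < j \<longrightarrow> y $ j < y $ i)}"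

lemma alcove_C_eq_chamber: "alcove_C = chamber UNIV"
  by (auto simp: alcove_C_def chamber_def)

lemma open_chamber: "open (chamber b)"
proof -
  have "chamber b = (\<Inter>i\<in>b. {y. 0 < y $ i} \<inter> {y. y $ i < 1/2}) \<inter>
      (\<Inter>i\<in>b. \<Inter>j\<in>{j\<in>b. i < j}. {y. y $ j < y $ i})"
    by (auto simp: chamber_def)
  also have "open \<dots>"
    by (intro open_Int open_INT ballI open_Collect_less continuous_intros) auto
  finally show ?thesis .
qed

lemma chamber_neq_UNIV: "b \<noteq> {} \<Longrightarrow> chamber b \<noteq> UNIV"
proof -
  assume "b \<noteq> {}"
  then have "0 \<notin> chamber b" by (auto simp: chamber_def)
  then show ?thesis by blast
qed

lemma chamber_mono: "b \<subseteq> c \<Longrightarrow> chamber c \<subseteq> chamber b"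
  by (auto simp: chamber_def)

section \<open>The exit time as a stopping time of the raw filtration\<close>

text \<open>The half-open interval makes this left-continuous in \<open>r\<close>: an entry before
  \<open>r\<close> is already visible at some rational time below \<open>r\<close>.\<close>

definition entered :: "(real \<Rightarrow> 'w \<Rightarrow> real) \<Rightarrow> nat \<Rightarrow> real \<Rightarrow> 'w \<Rightarrow> bool" where
  "entered Y n r \<omega> \<longleftrightarrow> (\<exists>q\<in>\<rat> \<inter> {0..<r}. Y q \<omega> < 1 / real (Suc n))"

text \<open>The hitting time of 0 by \<open>Y\<close> is the limit of \<open>r\<^sub>n = inf {r. entered Y n r}\<close>. For discontinuous
  paths this need not be a stopping time of the raw filtration: if \<open>r\<^sub>n = t\<close> for all large \<open>n\<close>,
  the path just after \<open>t\<close> is involved. Demanding that every \<open>r\<^sub>n\<close> be strictly exceeded by a later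
  one removes this case, and for continuous paths started away from 0 it is no restriction.\<close>

definition announced :: "(real \<Rightarrow> 'w \<Rightarrow> real) \<Rightarrow> real \<Rightarrow> 'w \<Rightarrow> bool" where
  "announced Y r \<omega> \<longleftrightarrow>
     (\<forall>n. \<exists>m. \<exists>p\<in>\<rat> \<inter> {0..<r}. entered Y n p \<omega> \<and> \<not> entered Y m p \<omega>)"

definition announced_time :: "(real \<Rightarrow> 'w \<Rightarrow> real) \<Rightarrow> 'w \<Rightarrow> ennreal" where
  "announced_time Y \<omega> = (INF r\<in>{r. 0 \<le> r \<and> announced Y r \<omega>}. ennreal r)"

lemma entered_mono: "entered Y n r \<omega> \<Longrightarrow> r \<le> s \<Longrightarrow> entered Y n s \<omega>"
  by (auto simp: entered_def)

lemma announced_mono: "announced Y r \<omega> \<Longrightarrow> r \<le> s \<Longrightarrow> announced Y s \<omega>"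
  unfolding announced_def by fastforce

lemma announcedE:
  assumes "announced Y r \<omega>"
  obtains m p where "p \<in> \<rat>" "0 \<le> p" "p < r" "entered Y n p \<omega>" "\<not> entered Y m p \<omega>"
proof -
  have "\<exists>m. \<exists>p\<in>\<rat> \<inter> {0..<r}. entered Y n p \<omega> \<and> \<not> entered Y m p \<omega>"
    using assms unfolding announced_def by blast
  then show ?thesis using that by auto
qed

text \<open>A witness time \<open>p > t\<close> is impossible: \<open>announced\<close> at
  \<open>p\<close> would show level \<open>m\<close> entered before \<open>p\<close>, although it is
  not entered by \<open>p\<close>. Hence \<open>p \<le> t\<close>, and left-continuity of
  \<open>entered\<close> moves the witness strictly below \<open>t\<close>.\<close>

lemma announced_right_continuous:
  assumes r: "\<And>r. t < r \<Longrightarrow> announced Y r \<omega>"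
  shows "announced Y t \<omega>"
  unfolding announced_def
proof
  fix n
  obtain m p where p: "p \<in> \<rat>" "0 \<le> p" "entered Y n p \<omega>" "\<not> entered Y m p \<omega>"
    using announcedE[OF r, of "t + 1" n] by (metis less_add_one)
  have "p \<le> t"
  proof (rule ccontr)
    assume "\<not> p \<le> t"
    then have "announced Y p \<omega>" by (intro r) simp
    then obtain p' where "p' < p" "entered Y m p' \<omega>"
      using announcedE by metis
    then show False using p(4) entered_mono less_imp_le by metis
  qed
  obtain q where q: "q \<in> \<rat>" "0 \<le> q" "q < p" "Y q \<omega> < 1 / real (Suc n)"
    using p(3) by (auto simp: entered_def)
  obtain p' where p': "p' \<in> \<rat>" "q < p'" "p' < p"
    using Rats_dense_in_real[OF q(3)] by auto
  have "entered Y n p' \<omega>" using q p' by (auto simp: entered_def)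
  moreover have "\<not> entered Y m p' \<omega>" using p(4) p'(3) entered_mono less_imp_le by metis
  moreover have "p' \<in> \<rat> \<inter> {0..<t}" using p' q(2) \<open>p \<le> t\<close> by auto
  ultimately show "\<exists>m. \<exists>p\<in>\<rat> \<inter> {0..<t}. entered Y n p \<omega> \<and> \<not> entered Y m p \<omega>" by blast
qed

text \<open>Right-continuity means that the infimum is attained, so the event on the left is decided
  by the path strictly before \<open>t\<close>, for arbitrary paths.\<close>

lemma announced_time_le_iff:
  assumes "0 \<le> t"
  shows "announced_time Y \<omega> \<le> ennreal t \<longleftrightarrow> announced Y t \<omega>"
proof
  assume le: "announced_time Y \<omega> \<le> ennreal t"
  show "announced Y t \<omega>"
  proof (rule announced_right_continuous)
    fix r assume "t < r"
    then have "announced_time Y \<omega> < ennreal r"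
      using le assms by (meson ennreal_lessI le_less_trans)
    then have "\<exists>s\<in>{r. 0 \<le> r \<and> announced Y r \<omega>}. ennreal s < ennreal r"
      by (simp only: announced_time_def INF_less_iff)
    then obtain s where s: "s \<in> {r. 0 \<le> r \<and> announced Y r \<omega>}" "ennreal s < ennreal r" ..
    then have "announced Y s \<omega>" by simp
    moreover have "s \<le> r"
      using s(2) ennreal_leI[of r s] by (meson linorder_not_le nle_le)
    ultimately show "announced Y r \<omega>" by (rule announced_mono)
  qed
next
  assume "announced Y t \<omega>"
  then show "announced_time Y \<omega> \<le> ennreal t"
    unfolding announced_time_def using assms by (intro INF_lower) simp
qed

text \<open>Just before its first zero \<open>Y\<close> is below any given level, while on a compact
  interval ending earlier it is bounded away from 0, so a deeper level is not yet entered. Without a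
  zero in [0,r] some level is never entered there at all.\<close>

lemma announced_iff_hits_0:
  assumes cont: "continuous_on {0..} (\<lambda>s. Y s \<omega>)" and nonneg: "\<And>s. 0 \<le> s \<Longrightarrow> 0 \<le> Y s \<omega>"
    and pos0: "0 < Y 0 \<omega>" and r: "0 \<le> r"
  shows "announced Y r \<omega> \<longleftrightarrow> (\<exists>s\<in>{0..r}. Y s \<omega> = 0)"
proof -
  have lower: "\<exists>n. \<forall>s\<in>{0..u}. 1 / real (Suc n) < Y s \<omega>"
    if "0 \<le> u" and pos: "\<And>s. 0 \<le> s \<Longrightarrow> s \<le> u \<Longrightarrow> Y s \<omega> \<noteq> 0" for u
  proof -
    have "\<exists>s\<in>{0..u}. \<forall>s'\<in>{0..u}. Y s \<omega> \<le> Y s' \<omega>"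
      using \<open>0 \<le> u\<close> by (intro continuous_attains_inf continuous_on_subset[OF cont]) auto
    then obtain s where s: "s \<in> {0..u}" "\<forall>s'\<in>{0..u}. Y s \<omega> \<le> Y s' \<omega>" by auto
    then have "0 < Y s \<omega>" using nonneg[of s] pos[of s] by auto
    then obtain n where "1 / real (Suc n) < Y s \<omega>"
      using reals_Archimedean[of "Y s \<omega>"] by (auto simp: inverse_eq_divide)
    then have "\<forall>s'\<in>{0..u}. 1 / real (Suc n) < Y s' \<omega>"
      using s(2) by (meson order_less_le_trans)
    then show ?thesis ..
  qed
  show ?thesis
  proof
    assume ann: "announced Y r \<omega>"
    show "\<exists>s\<in>{0..r}. Y s \<omega> = 0"
    proof (rule ccontr)
      assume "\<not> (\<exists>s\<in>{0..r}. Y s \<omega> = 0)"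
      then obtain n where n: "\<forall>s\<in>{0..r}. 1 / real (Suc n) < Y s \<omega>"
        using lower[OF r] by auto
      obtain p where p: "p < r" "entered Y n p \<omega>"
        using announcedE[OF ann] by metis
      then obtain q where "0 \<le> q" "q < p" "Y q \<omega> < 1 / real (Suc n)"
        by (auto simp: entered_def)
      then show False using bspec[OF n, of q] p(1) by simp
    qed
  next
    assume "\<exists>s\<in>{0..r}. Y s \<omega> = 0"
    then have ne: "{s\<in>{0..r}. Y s \<omega> = 0} \<noteq> {}" by auto
    have "closed ({0..r} \<inter> (\<lambda>s. Y s \<omega>) -` {0})"
      by (intro continuous_closed_preimage continuous_on_subset[OF cont]) auto
    moreover have "{0..r} \<inter> (\<lambda>s. Y s \<omega>) -` {0} = {s\<in>{0..r}. Y s \<omega> = 0}" by auto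
    moreover have "bounded {s\<in>{0..r}. Y s \<omega> = 0}"
      by (rule bounded_subset[of "{0..r}"]) auto
    ultimately have "compact {s\<in>{0..r}. Y s \<omega> = 0}"
      by (simp add: compact_eq_bounded_closed)
    then obtain s where s: "0 \<le> s" "s \<le> r" "Y s \<omega> = 0"
      and first: "\<And>s'. 0 \<le> s' \<Longrightarrow> s' \<le> r \<Longrightarrow> Y s' \<omega> = 0 \<Longrightarrow> s \<le> s'"
      using compact_attains_inf[OF _ ne] by auto
    \<comment> \<open>Starting away from 0 leaves room for rationals \<open>q < p < s\<close> before
      the first zero.\<close>
    have "0 < s" using pos0 s by (metis less_eq_real_def less_irrefl)
    show "announced Y r \<omega>"
      unfolding announced_def
    proof
      fix n
      have "continuous (at s within {0..}) (\<lambda>s. Y s \<omega>)"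
        using cont s(1) by (simp add: continuous_on_eq_continuous_within)
      then obtain d where d: "d > 0"
        "\<And>s'. s' \<in> {0..} \<Longrightarrow> dist s' s < d \<Longrightarrow> dist (Y s' \<omega>) (Y s \<omega>) < 1 / real (Suc n)"
        unfolding continuous_within_eps_delta by (metis of_nat_0_less_iff zero_less_Suc zero_less_divide_1_iff)
      have "max 0 (s - d) < s" using d(1) \<open>0 < s\<close> by auto
      then obtain q where q: "q \<in> \<rat>" "max 0 (s - d) < q" "q < s"
        using Rats_dense_in_real by blast
      then have "Y q \<omega> < 1 / real (Suc n)"
        using d(2)[of q] s(3) by (auto simp: dist_real_def)
      obtain p where p: "p \<in> \<rat>" "q < p" "p < s"
        using Rats_dense_in_real[OF q(3)] by auto
      have "entered Y n p \<omega>"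
        using q p \<open>Y q \<omega> < _\<close> by (auto simp: entered_def)
      moreover obtain m where "\<forall>s\<in>{0..p}. 1 / real (Suc m) < Y s \<omega>"
        using lower[of p] first p q s(2) by fastforce
      then have "\<not> entered Y m p \<omega>"
        by (force simp: entered_def)
      moreover have "p \<in> \<rat> \<inter> {0..<r}" using p q s by auto
      ultimately show "\<exists>m. \<exists>p\<in>\<rat> \<inter> {0..<r}. entered Y n p \<omega> \<and> \<not> entered Y m p \<omega>" by blast
    qed
  qed
qed

lemma stopping_time_announced_time:
  assumes F: "\<And>u. {} \<in> sets (F u)"
    and Y: "\<And>q u. 0 \<le> q \<Longrightarrow> ennreal q \<le> u \<Longrightarrow> Y q \<in> borel_measurable (F u)"
  shows "stopping_time F (announced_time Y)"
proof
  fix u :: ennreal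
  show "Measurable.pred (F u) (\<lambda>\<omega>. announced_time Y \<omega> \<le> u)"
  proof (cases u)
    case (real t)
    have ent: "Measurable.pred (F u) (entered Y n p)" if "p \<in> \<rat> \<inter> {0..<t}" for n p
      unfolding entered_def using that real
      by (intro measurable_pred_countable borel_measurable_pred_less Y)
        (auto intro: countable_Int1 countable_rat)
    have "Measurable.pred (F u) (announced Y t)"
      unfolding announced_def
      by (intro pred_intros_countable measurable_pred_countable pred_intros_logic ent)
        (auto intro: countable_Int1 countable_rat)
    then show ?thesis
      using real by (simp add: announced_time_le_iff)
  qed auto
qed

section \<open>Independence of blocks of coordinates\<close>

definition coord_subspace :: "'n set \<Rightarrow> (real^'n::finite) set" where
  "coord_subspace b = {y. \<forall>i. i \<notin> b \<longrightarrow> y $ i = 0}"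

lemma subspace_coord_subspace: "subspace (coord_subspace b)"
  by (auto simp: subspace_def coord_subspace_def)

text \<open>The independence hypothesis indexes families by the subspaces themselves; injectivity
  allows its product to be rewritten over blocks.\<close>

lemma inj_coord_subspace: "inj coord_subspace"
proof (rule injI)
  fix b c :: "'n::finite set" assume eq: "coord_subspace b = coord_subspace c"
  have "i \<in> b \<longleftrightarrow> axis i 1 \<in> coord_subspace b" for i :: 'n and b :: "'n set"
    by (auto simp: coord_subspace_def axis_def)
  then show "b = c" using eq by blast
qed

lemma orthogonal_coord_subspaces:
  assumes "b \<inter> c = {}" "u \<in> coord_subspace b" "v \<in> coord_subspace c"
  shows "orthogonal u v"
proof -
  have "u $ i * v $ i = 0" for i
    using assms by (auto simp: coord_subspace_def)
  then show ?thesis unfolding orthogonal_def inner_vec_def by (intro sum.neutral) simp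
qed

lemma orth_proj_coord_subspace:
  "orth_proj (coord_subspace b) y = (\<chi> i. if i \<in> b then y $ i else 0)"
  unfolding orth_proj_def
proof (rule the_equality)
  let ?z = "\<chi> i. if i \<in> b then y $ i else 0"
  have z: "y - ?z \<in> coord_subspace (- b)" "?z \<in> coord_subspace b"
    by (auto simp: coord_subspace_def)
  then show "?z \<in> coord_subspace b \<and> (\<forall>v\<in>coord_subspace b. orthogonal (y - ?z) v)"
    using orthogonal_coord_subspaces[of "- b" b] by auto
  fix z assume "z \<in> coord_subspace b \<and> (\<forall>v\<in>coord_subspace b. orthogonal (y - z) v)"
  then have z: "z \<in> coord_subspace b" and orth: "\<And>v. v \<in> coord_subspace b \<Longrightarrow> orthogonal (y - z) v"
    by auto
  show "z = ?z"
  proof (rule vec_eq_iff[THEN iffD2], rule allI)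
    fix i
    show "z $ i = ?z $ i"
    proof (cases "i \<in> b")
      case True
      then have "axis i 1 \<in> coord_subspace b"
        by (auto simp: coord_subspace_def axis_def)
      from orth[OF this] have "(y - z) $ i = 0"
        by (simp add: orthogonal_def inner_axis)
      then show ?thesis using True by simp
    qed (use z in \<open>auto simp: coord_subspace_def\<close>)
  qed
qed

lemma orth_proj_mem_chamber_iff: "orth_proj (coord_subspace b) y \<in> chamber b \<longleftrightarrow> y \<in> chamber b"
  by (auto simp: orth_proj_coord_subspace chamber_def)

lemma continuous_on_orth_proj_coord_subspace [continuous_intros]:
  assumes "continuous_on S f"
  shows "continuous_on S (\<lambda>x. orth_proj (coord_subspace b) (f x))"
  unfolding orth_proj_coord_subspace
proof (rule continuous_on_vec_lambda)
  fix i show "continuous_on S (\<lambda>x. if i \<in> b then f x $ i else 0)"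
    using assms by (cases "i \<in> b") (auto intro!: continuous_intros)
qed

lemma process_familyD:
  assumes "process_family M P X"
  shows "0 \<le> t \<Longrightarrow> X t \<in> M \<rightarrow>\<^sub>M borel" "prob_space (P x)" "sets (P x) = sets M"
    "space (P x) = space M" "AE \<omega> in P x. X 0 \<omega> = x"
    "0 \<le> t \<Longrightarrow> X t \<in> P x \<rightarrow>\<^sub>M borel"
proof -
  show *: "0 \<le> t \<Longrightarrow> X t \<in> M \<rightarrow>\<^sub>M borel" "prob_space (P x)" "sets (P x) = sets M"
    "AE \<omega> in P x. X 0 \<omega> = x"
    using assms unfolding process_family_def by blast+
  show "space (P x) = space M" using *(3) by (rule sets_eq_imp_space_eq)
  show "0 \<le> t \<Longrightarrow> X t \<in> P x \<rightarrow>\<^sub>M borel" using * by (simp cong: measurable_cong_sets)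
qed

lemma measurable_sets_Collect_in:
  assumes "f \<in> N \<rightarrow>\<^sub>M K" "A \<in> sets K"
  shows "{\<omega>\<in>space N. f \<omega> \<in> A} \<in> sets N"
proof -
  have "{\<omega>\<in>space N. f \<omega> \<in> A} = f -` A \<inter> space N" by auto
  then show ?thesis using measurable_sets[OF assms] by simp
qed

text \<open>Disjoint blocks span orthogonal coordinate subspaces, and membership in
  \<open>chamber b\<close> depends only on the projection onto the subspace of \<open>b\<close>. So,
  on continuous paths, survival of a block is an event of one of the independent
  projections.\<close>

lemma prob_survival_indep:
  fixes P :: "real^'n::{finite,linorder} \<Rightarrow> 'w measure"
  assumes fam: "process_family M P X" and cont: "AE \<omega> in P x. continuous_on {0..} (\<lambda>t. X t \<omega>)"
    and indep: "indep_orthogonal_components P X"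
    and Q: "disjoint Q" "{} \<notin> Q" "Q \<noteq> {}" and u: "0 \<le> u"
  shows "measure (P x) {\<omega>\<in>space M. \<forall>b\<in>Q. path X \<omega> \<in> stays (chamber b) u} =
    (\<Prod>b\<in>Q. measure (P x) {\<omega>\<in>space M. path X \<omega> \<in> stays (chamber b) u})"
proof -
  interpret prob_space "P x" by (rule process_familyD(2)[OF fam])
  note sp = process_familyD(4)[OF fam, of x] and Xm = process_familyD(6)[OF fam]
  let ?S = "coord_subspace ` Q" and ?A = "\<lambda>S. stays (chamber (inv coord_subspace S)) u"
  let ?Y = "\<lambda>S. path (\<lambda>t \<omega>. orth_proj S (X t \<omega>))"
  have fin: "finite Q" by simp
  have "indep_vars (\<lambda>_. path_space) ?Y ?S"
  proof -
    have "orthogonal v w" if "b \<in> Q" "c \<in> Q" "coord_subspace b \<noteq> coord_subspace c"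
      "v \<in> coord_subspace b" "w \<in> coord_subspace c" for b c v w
      using disjointD[OF Q(1) that(1,2)] that(3-5) orthogonal_coord_subspaces by blast
    then have "pairwise (\<lambda>S S'. \<forall>v\<in>S. \<forall>w\<in>S'. orthogonal v w) ?S"
      unfolding pairwise_def by auto
    moreover have "\<forall>S\<in>?S. subspace S" using subspace_coord_subspace by blast
    ultimately show ?thesis
      using indep[unfolded indep_orthogonal_components_def, THEN spec, of ?S] by blast
  qed
  then have "prob (\<Inter>S\<in>?S. ?Y S -` ?A S \<inter> space (P x)) = (\<Prod>S\<in>?S. prob (?Y S -` ?A S \<inter> space (P x)))"
    by (rule indep_varsD) (use Q fin stays_in_sets in auto)
  also have "\<dots> = (\<Prod>b\<in>Q. prob (?Y (coord_subspace b) -` stays (chamber b) u \<inter> space (P x)))"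
    by (subst prod.reindex) (auto simp: inv_f_f[OF inj_coord_subspace] intro: inj_on_subset[OF inj_coord_subspace])
  also have "(\<Inter>S\<in>?S. ?Y S -` ?A S \<inter> space (P x)) =
      {\<omega>\<in>space M. \<forall>b\<in>Q. ?Y (coord_subspace b) \<omega> \<in> stays (chamber b) u}"
    using Q(3) by (auto simp: inv_f_f[OF inj_coord_subspace] sp)
  finally have eq: "prob {\<omega>\<in>space M. \<forall>b\<in>Q. ?Y (coord_subspace b) \<omega> \<in> stays (chamber b) u} =
      (\<Prod>b\<in>Q. prob (?Y (coord_subspace b) -` stays (chamber b) u \<inter> space (P x)))" .
  have Ym: "?Y (coord_subspace b) \<in> P x \<rightarrow>\<^sub>M path_space" for b
    by (intro measurable_path measurable_compose[OF Xm] borel_measurable_continuous_onI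
        continuous_intros)
  have Xp: "path X \<in> P x \<rightarrow>\<^sub>M path_space"
    using Xm by (rule measurable_path)
  have ae: "AE \<omega> in P x. \<forall>b\<in>Q. ?Y (coord_subspace b) \<omega> \<in> stays (chamber b) u \<longleftrightarrow>
      path X \<omega> \<in> stays (chamber b) u"
    using cont
  proof eventually_elim
    case (elim \<omega>)
    show ?case
    proof
      fix b assume "b \<in> Q"
      then have "chamber b \<noteq> UNIV" using Q(2) chamber_neq_UNIV by metis
      moreover have "continuous_on {0..} (\<lambda>t. orth_proj (coord_subspace b) (X t \<omega>))"
        using elim by (intro continuous_intros)
      ultimately show "?Y (coord_subspace b) \<omega> \<in> stays (chamber b) u \<longleftrightarrow>
          path X \<omega> \<in> stays (chamber b) u"
        using elim u by (simp add: path_mem_stays_iff open_chamber orth_proj_mem_chamber_iff)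
    qed
  qed
  have "prob {\<omega>\<in>space M. \<forall>b\<in>Q. ?Y (coord_subspace b) \<omega> \<in> stays (chamber b) u} =
      prob {\<omega>\<in>space M. \<forall>b\<in>Q. path X \<omega> \<in> stays (chamber b) u}"
  proof (rule measure_eq_AE)
    show "AE \<omega> in P x. \<omega> \<in> {\<omega>\<in>space M. \<forall>b\<in>Q. ?Y (coord_subspace b) \<omega> \<in> stays (chamber b) u} \<longleftrightarrow>
        \<omega> \<in> {\<omega>\<in>space M. \<forall>b\<in>Q. path X \<omega> \<in> stays (chamber b) u}"
      using ae by eventually_elim auto
    show "{\<omega>\<in>space M. \<forall>b\<in>Q. ?Y (coord_subspace b) \<omega> \<in> stays (chamber b) u} \<in> events"
      unfolding sp[symmetric]
      by (intro sets.sets_Collect_finite_All fin measurable_sets_Collect_in[OF Ym stays_in_sets])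
    show "{\<omega>\<in>space M. \<forall>b\<in>Q. path X \<omega> \<in> stays (chamber b) u} \<in> events"
      unfolding sp[symmetric]
      by (intro sets.sets_Collect_finite_All fin measurable_sets_Collect_in[OF Xp stays_in_sets])
  qed
  moreover have "prob (?Y (coord_subspace b) -` stays (chamber b) u \<inter> space (P x)) =
      prob {\<omega>\<in>space M. path X \<omega> \<in> stays (chamber b) u}" if "b \<in> Q" for b
  proof (rule measure_eq_AE)
    show "AE \<omega> in P x. \<omega> \<in> ?Y (coord_subspace b) -` stays (chamber b) u \<inter> space (P x) \<longleftrightarrow>
        \<omega> \<in> {\<omega>\<in>space M. path X \<omega> \<in> stays (chamber b) u}"
      using ae by eventually_elim (use that sp in auto)
    show "?Y (coord_subspace b) -` stays (chamber b) u \<inter> space (P x) \<in> events"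
      by (rule measurable_sets[OF Ym stays_in_sets])
    show "{\<omega>\<in>space M. path X \<omega> \<in> stays (chamber b) u} \<in> events"
      using measurable_sets[OF Xp stays_in_sets] by (simp add: vimage_def Int_def conj_commute sp)
  qed
  ultimately show ?thesis using eq by simp
qed

section \<open>Cancellation at the boundary of the alcove\<close>

definition survive :: "'n set set \<Rightarrow> real \<Rightarrow> (real \<Rightarrow> real^'n::{finite,linorder}) set" where
  "survive Q u = {p\<in>space path_space. \<forall>b\<in>Q. p \<in> stays (chamber b) u}"

lemma survive_in_sets: "survive Q u \<in> sets path_space"
  unfolding survive_def
  by (intro sets.sets_Collect_finite_All) (simp_all add: stays_in_sets sets.Int_space_eq2 flip: Int_def Collect_mem_eq)

lemma path_mem_survive_iff:
  assumes "continuous_on {0..} (\<lambda>t. X t \<omega>)" "{} \<notin> Q" "0 \<le> u"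
  shows "path X \<omega> \<in> survive Q u \<longleftrightarrow> (\<forall>s\<in>{0..u}. \<forall>b\<in>Q. X s \<omega> \<in> chamber b)"
proof -
  have "path X \<omega> \<in> stays (chamber b) u \<longleftrightarrow> (\<forall>s\<in>{0..u}. X s \<omega> \<in> chamber b)" if "b \<in> Q" for b
    using assms that by (intro path_mem_stays_iff open_chamber chamber_neq_UNIV) auto
  then show ?thesis unfolding survive_def by auto
qed

lemma matching_nonempty_blocks: "Q \<in> matchings I \<Longrightarrow> {} \<notin> Q"
  by (auto simp: matchings_def partition_on_def)

text \<open>Survival already fails at time 0, because the process starts at \<open>y\<close> almost
  surely.\<close>

lemma prob_survive_eq_0:
  fixes P :: "real^'n::{finite,linorder} \<Rightarrow> 'w measure"
  assumes fam: "process_family M P X" and cont: "AE \<omega> in P y. continuous_on {0..} (\<lambda>t. X t \<omega>)"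
    and "{} \<notin> Q" "c \<in> Q" "y \<notin> chamber c" "0 \<le> u"
  shows "measure (P y) {\<omega>\<in>space (P y). path X \<omega> \<in> survive Q u} = 0"
proof -
  interpret prob_space "P y" by (rule process_familyD(2)[OF fam])
  have "AE \<omega> in P y. path X \<omega> \<notin> survive Q u"
    using cont process_familyD(5)[OF fam]
  proof eventually_elim
    case (elim \<omega>)
    then show ?case using assms(3-) by (auto simp: path_mem_survive_iff intro!: bexI[of _ 0])
  qed
  moreover have "{\<omega>\<in>space (P y). path X \<omega> \<in> survive Q u} \<in> events"
    by (rule measurable_sets_Collect_in[OF measurable_path[OF process_familyD(6)[OF fam]] survive_in_sets])
  ultimately show ?thesis
    by (intro prob_eq_0_AE) auto
qed

definition swap_coords :: "'n \<Rightarrow> 'n \<Rightarrow> real^'n \<Rightarrow> real^'n" where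
  "swap_coords a b y = (\<chi> i. y $ transp a b i)"

lemma swap_coords_in_affine_weyl_C: "swap_coords a b \<in> affine_weyl_C"
proof -
  have "signed_permutation (swap_coords a b)"
    unfolding signed_permutation_def swap_coords_def
    by (intro exI[of _ "transp a b"] exI[of _ "\<lambda>_. 1"]) auto
  moreover have "swap_coords a b = (\<lambda>x. swap_coords a b x + 0)" by simp
  ultimately show ?thesis
    unfolding affine_weyl_C_def by (intro CollectI exI[of _ "swap_coords a b"] exI[of _ 0]) auto
qed

lemma swap_coords_mem_chamber_image_iff:
  fixes a b :: "'n::{finite,linorder}"
  assumes "strict_mono_on c (transp a b)"
  shows "swap_coords a b y \<in> chamber (transp a b ` c) \<longleftrightarrow> y \<in> chamber c"
proof -
  have "transp a b i < transp a b j \<longleftrightarrow> i < j" if "i \<in> c" "j \<in> c" for i j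
    using assms that by (metis linorder_neqE order_less_asym strict_mono_onD)
  then show ?thesis
    by (auto simp: chamber_def swap_coords_def)
qed

text \<open>The point \<open>y\<close> is fixed by the swap, so the law under \<open>P y\<close> is
  invariant. No block of \<open>Q\<close> contains both \<open>a\<close> and \<open>b\<close>, so
  the transposition is increasing on each block \<open>c\<close> and the swap carries
  \<open>chamber c\<close> to the chamber of the image block.\<close>

lemma prob_survive_swap:
  fixes P :: "real^'n::{finite,linorder} \<Rightarrow> 'w measure"
  assumes fam: "process_family M P X" and cont: "AE \<omega> in P y. continuous_on {0..} (\<lambda>t. X t \<omega>)"
    and law: "law (P y) (\<lambda>t \<omega>. swap_coords a b (X t \<omega>)) = law (P (swap_coords a b y)) X"
    and yab: "y $ a = y $ b" and ab: "a < b" and adj: "\<forall>c. c \<le> a \<or> b \<le> c"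
    and Q: "Q \<in> matchings UNIV" "{a, b} \<notin> Q" and u: "0 \<le> u"
  shows "measure (P y) {\<omega>\<in>space (P y). path X \<omega> \<in> survive (image (transp a b) ` Q) u} =
    measure (P y) {\<omega>\<in>space (P y). path X \<omega> \<in> survive Q u}"
proof -
  interpret prob_space "P y" by (rule process_familyD(2)[OF fam])
  let ?Q = "image (transp a b) ` Q" and ?X = "\<lambda>t \<omega>. swap_coords a b (X t \<omega>)"
  have Q': "?Q \<in> matchings UNIV" using Q by (intro image_transpose_matchings) auto
  have swy: "swap_coords a b y = y"
    using yab by (auto simp: swap_coords_def vec_eq_iff Transposition.transpose_def)
  have Xm: "0 \<le> t \<Longrightarrow> X t \<in> P y \<rightarrow>\<^sub>M borel" for t by (rule process_familyD(6)[OF fam])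
  have Xp: "path X \<in> P y \<rightarrow>\<^sub>M path_space"
    using Xm by (rule measurable_path)
  have Xp': "path ?X \<in> P y \<rightarrow>\<^sub>M path_space"
    unfolding swap_coords_def
    by (intro measurable_path measurable_compose[OF Xm] borel_measurable_continuous_onI
        continuous_intros)
  have dist: "measure (law (P y) Y) (survive R u) = prob {\<omega>\<in>space (P y). path Y \<omega> \<in> survive R u}"
    if "path Y \<in> P y \<rightarrow>\<^sub>M path_space" for Y R
    using that survive_in_sets[of R u]
    by (simp add: law_def measure_distr vimage_def Int_def conj_commute)
  have mono: "strict_mono_on c (transp a b)" if "c \<in> Q" for c
  proof (rule strict_mono_on_transpose_adjacent[OF ab])
    show "a \<notin> c \<or> b \<notin> c"
    proof (rule ccontr)
      assume *: "\<not> (a \<notin> c \<or> b \<notin> c)"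
      then have "a \<in> c" by simp
      from matching_block[OF Q(1) that this] show False
        using * ab Q(2) that by (metis insert_iff less_irrefl singletonD)
    qed
  qed (use adj in auto)
  have "prob {\<omega>\<in>space (P y). path X \<omega> \<in> survive ?Q u} =
      prob {\<omega>\<in>space (P y). path ?X \<omega> \<in> survive ?Q u}"
    using dist[OF Xp] dist[OF Xp'] law swy by simp
  also have "\<dots> = prob {\<omega>\<in>space (P y). path X \<omega> \<in> survive Q u}"
  proof (rule measure_eq_AE)
    show "AE \<omega> in P y. \<omega> \<in> {\<omega>\<in>space (P y). path ?X \<omega> \<in> survive ?Q u} \<longleftrightarrow>
        \<omega> \<in> {\<omega>\<in>space (P y). path X \<omega> \<in> survive Q u}"
      using cont
    proof eventually_elim
      case (elim \<omega>)
      then have "continuous_on {0..} (\<lambda>t. ?X t \<omega>)"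
        unfolding swap_coords_def by (intro continuous_intros)
      then show ?case
        using elim u matching_nonempty_blocks[OF Q(1)] matching_nonempty_blocks[OF Q'] mono
        by (auto simp: path_mem_survive_iff swap_coords_mem_chamber_image_iff)
    qed
  qed (rule measurable_sets_Collect_in[OF Xp' survive_in_sets]
      measurable_sets_Collect_in[OF Xp survive_in_sets])+
  finally show ?thesis .
qed

lemma sum_survive_boundary_eq_0:
  fixes P :: "real^'n::{finite,linorder} \<Rightarrow> 'w measure"
  assumes refl: "reflectable affine_weyl_C M P X"
    and y: "y \<in> closure alcove_C" "y \<notin> alcove_C" and u: "0 \<le> u"
  shows "(\<Sum>Q\<in>matchings UNIV. matching_sign UNIV Q *
    measure (P y) {\<omega>\<in>space (P y). path X \<omega> \<in> survive Q u}) = 0"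
proof -
  have fam: "process_family M P X" and cont: "AE \<omega> in P y. continuous_on {0..} (\<lambda>t. X t \<omega>)"
    and law: "law (P y) (\<lambda>t \<omega>. swap_coords a b (X t \<omega>)) = law (P (swap_coords a b y)) X" for a b
    using refl swap_coords_in_affine_weyl_C unfolding reflectable_def by blast+
  show ?thesis
  \<comment> \<open>If a coordinate leaves the open interval, the block containing its index fails
    at time 0; every matching has such a block, so every summand vanishes.\<close>
  proof (cases "\<forall>i. 0 < y $ i \<and> y $ i < 1/2")
    case False
    then obtain i where i: "\<not> (0 < y $ i \<and> y $ i < 1/2)" by auto
    have "measure (P y) {\<omega>\<in>space (P y). path X \<omega> \<in> survive Q u} = 0" if Q: "Q \<in> matchings UNIV" for Q
    proof -
      have "i \<in> \<Union>Q"
        using Q by (simp add: matchings_def partition_on_def)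
      then obtain c where "c \<in> Q" "i \<in> c" by blast
      then show ?thesis
        using i u by (intro prob_survive_eq_0[OF fam cont matching_nonempty_blocks[OF Q]])
          (auto simp: chamber_def)
    qed
    then show ?thesis by simp
  next
    case True
    have "closed {z :: real^'n::{finite,linorder}. \<forall>i j. i < j \<longrightarrow> z $ j \<le> z $ i}"
      by (intro closed_Collect_all closed_Collect_imp closed_Collect_le continuous_intros) auto
    moreover have "alcove_C \<subseteq> {z :: real^'n::{finite,linorder}. \<forall>i j. i < j \<longrightarrow> z $ j \<le> z $ i}"
      by (auto simp: alcove_C_def less_imp_le)
    ultimately have le: "y $ j \<le> y $ i" if "i < j" for i j
      using y(1) that closure_minimal by blast
    obtain a j where aj: "a < j" "y $ a = y $ j"
      using y(2) True le by (force simp: alcove_C_def)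
    \<comment> \<open>The successor of \<open>a\<close>. Weak monotonicity squeezes coordinate
      \<open>b\<close> between the equal coordinates \<open>a\<close> and \<open>j\<close>.\<close>
    define b where "b = Min {c. a < c}"
    have "b \<in> {c. a < c}"
      unfolding b_def by (rule Min_in) (use aj in auto)
    then have ab: "a < b" by simp
    have bmin: "b \<le> c" if "a < c" for c
      unfolding b_def by (rule Min_le) (use that in auto)
    have "b \<le> j" using bmin aj by simp
    then have "y $ j \<le> y $ b" using le[of b j] by (cases "b = j") auto
    then have yab: "y $ a = y $ b" using le[OF ab] aj by simp
    have adj: "\<forall>c. c \<le> a \<or> b \<le> c" using bmin by (meson not_le)
    have zero: "measure (P y) {\<omega>\<in>space (P y). path X \<omega> \<in> survive Q u} = 0"
      if "Q \<in> matchings UNIV" "{a, b} \<in> Q" for Q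
      using that yab ab u
      by (intro prob_survive_eq_0[OF fam cont matching_nonempty_blocks]) (auto simp: chamber_def)
    show ?thesis
    proof (rule sum_matching_sign_swap_eq_0[OF _ _ _ ab])
      fix Q :: "'n set set" assume Q: "Q \<in> matchings UNIV"
      show "measure (P y) {\<omega>\<in>space (P y). path X \<omega> \<in> survive (image (transp a b) ` Q) u} =
          measure (P y) {\<omega>\<in>space (P y). path X \<omega> \<in> survive Q u}"
      proof (cases "{a, b} \<in> Q")
        case True
        moreover have "transp a b ` {a, b} = {a, b}" by auto
        ultimately have "{a, b} \<in> image (transp a b) ` Q" by (metis image_eqI)
        moreover have "image (transp a b) ` Q \<in> matchings UNIV"
          using Q by (intro image_transpose_matchings) auto
        ultimately show ?thesis using zero Q True by simp
      next
        case False
        then show ?thesis using prob_survive_swap[OF fam cont law yab ab adj Q _ u] by simp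
      qed
    qed (use adj zero in auto)
  qed
qed

section \<open>The strong Markov property at the exit time\<close>

lemma space_natural_filtration: "space (natural_filtration M X u) = space M"
  by (simp add: natural_filtration_def)

lemma measurable_natural_filtration:
  assumes "0 \<le> q" "ennreal q \<le> u"
  shows "X q \<in> natural_filtration M X u \<rightarrow>\<^sub>M borel"
proof -
  let ?I = "{s. 0 \<le> s \<and> ennreal s \<le> u}"
  have "(\<lambda>\<omega>. \<lambda>s\<in>?I. X s \<omega>) \<in> natural_filtration M X u \<rightarrow>\<^sub>M Pi\<^sub>M ?I (\<lambda>_. borel)"
    unfolding natural_filtration_def
    by (rule measurable_vimage_algebra1) (auto simp: space_PiM)
  from measurable_compose[OF this measurable_component_singleton[of q]] assms
  show ?thesis by simp
qed

lemma sets_natural_filtration_subset: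
  assumes "space N = space M" "\<And>q. 0 \<le> q \<Longrightarrow> ennreal q \<le> u \<Longrightarrow> X q \<in> N \<rightarrow>\<^sub>M borel"
  shows "sets (natural_filtration M X u) \<subseteq> sets N"
  unfolding natural_filtration_def using assms
  by (intro sets_image_in_sets measurable_restrict) auto

lemma filtration_natural_filtration: "filtration (space M) (natural_filtration M X)"
proof
  show "sets (natural_filtration M X u) \<subseteq> sets (natural_filtration M X v)" if "u \<le> v" for u v
    using that by (intro sets_natural_filtration_subset measurable_natural_filtration)
      (auto simp: space_natural_filtration)
qed (rule space_natural_filtration)

text \<open>For open \<open>A\<close> other than the whole space, the distance to the complement is
  continuous in the point and vanishes exactly outside \<open>A\<close>; leaving \<open>A\<close>
  thus becomes hitting 0.\<close>

definition hitting_time :: "(real \<Rightarrow> 'w \<Rightarrow> 'v::euclidean_space) \<Rightarrow> 'v set \<Rightarrow> 'w \<Rightarrow> ennreal" where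
  "hitting_time X A = announced_time (\<lambda>s \<omega>. infdist (X s \<omega>) (- A))"

lemma stopping_time_hitting_time:
  "stopping_time (natural_filtration M X) (hitting_time X A)"
  unfolding hitting_time_def
  by (intro stopping_time_announced_time measurable_infdist_comp measurable_natural_filtration) auto

lemma hitting_time_le_iff:
  assumes cont: "continuous_on {0..} (\<lambda>s. X s \<omega>)" and A: "open A" "A \<noteq> UNIV"
    and X0: "X 0 \<omega> \<in> A" and r: "0 \<le> r"
  shows "hitting_time X A \<omega> \<le> ennreal r \<longleftrightarrow> (\<exists>s\<in>{0..r}. X s \<omega> \<notin> A)"
proof -
  have iff: "infdist y (- A) = 0 \<longleftrightarrow> y \<notin> A" for y
    using A in_closed_iff_infdist_zero[of "- A" y] by auto
  have "0 < infdist (X 0 \<omega>) (- A)"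
    using iff X0 infdist_nonneg by (metis less_eq_real_def)
  then have "announced (\<lambda>s \<omega>. infdist (X s \<omega>) (- A)) r \<omega> \<longleftrightarrow>
      (\<exists>s\<in>{0..r}. infdist (X s \<omega>) (- A) = 0)"
    using cont r by (intro announced_iff_hits_0 continuous_intros infdist_nonneg)
  then show ?thesis
    unfolding hitting_time_def announced_time_le_iff[OF r] iff .
qed

lemma exit_time_eq_hitting_time:
  assumes "continuous_on {0..} (\<lambda>s. X s \<omega>)" "open A" "A \<noteq> UNIV" "X 0 \<omega> \<in> A"
  shows "exit_time X A \<omega> = hitting_time X A \<omega>"
proof (rule antisym)
  note iff = hitting_time_le_iff[of X, OF assms]
  show "hitting_time X A \<omega> \<le> exit_time X A \<omega>"
    unfolding exit_time_def
  proof (rule INF_greatest)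
    fix s assume s: "s \<in> {s. 0 \<le> s \<and> X s \<omega> \<notin> A}"
    then show "hitting_time X A \<omega> \<le> ennreal s" by (subst iff) auto
  qed
  show "exit_time X A \<omega> \<le> hitting_time X A \<omega>"
  proof (cases "hitting_time X A \<omega>")
    case (real r)
    then obtain s where s: "s \<in> {0..r}" "X s \<omega> \<notin> A" using iff[of r] by auto
    then have "exit_time X A \<omega> \<le> ennreal s"
      unfolding exit_time_def by (intro INF_lower) auto
    also have "\<dots> \<le> ennreal r" using s by (intro ennreal_leI) auto
    finally show ?thesis using real by simp
  qed simp
qed

lemma hitting_time_finiteD:
  assumes good: "continuous_on {0..} (\<lambda>s. X s \<omega>)" "open A" "A \<noteq> UNIV" "X 0 \<omega> \<in> A"
    and T: "hitting_time X A \<omega> = ennreal r" "0 \<le> r"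
  shows "X r \<omega> \<notin> A" "\<And>s. 0 \<le> s \<Longrightarrow> s < r \<Longrightarrow> X s \<omega> \<in> A" "X r \<omega> \<in> closure A"
proof -
  note iff = hitting_time_le_iff[of X, OF good]
  obtain s where s: "s \<in> {0..r}" "X s \<omega> \<notin> A" using iff[of r] T by auto
  then have "ennreal r \<le> ennreal s" using iff[of s] T by auto
  then have "s = r" using s T by auto
  then show "X r \<omega> \<notin> A" using s by simp
  then have "0 < r" using T(2) good(4) by (metis less_eq_real_def)
  show before: "X s \<omega> \<in> A" if "0 \<le> s" "s < r" for s
  proof (rule ccontr)
    assume "X s \<omega> \<notin> A"
    then have "ennreal r \<le> ennreal s" using iff[of s] T that by auto
    then show False using that by simp
  qed
  have "(\<lambda>s. X s \<omega>) ` closure {0..<r} \<subseteq> closure A"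
    using \<open>0 < r\<close> before closure_subset[of A]
    by (intro image_closure_subset continuous_on_subset[OF good(1)]) auto
  then show "X r \<omega> \<in> closure A" using \<open>0 < r\<close> by auto
qed

lemma measurable_hitting_time:
  assumes "\<And>t. 0 \<le> t \<Longrightarrow> X t \<in> M \<rightarrow>\<^sub>M borel"
  shows "hitting_time X A \<in> borel_measurable M"
  using assms
  by (intro measurable_stopping_time[OF stopping_time_hitting_time[of M]] sets_natural_filtration_subset)
    (auto simp: space_natural_filtration)

text \<open>The map \<open>X (T + s)\<close> is a limit of maps in which \<open>T\<close> takes
  countably many values; the limit exists by path continuity, hence only off a null set, which
  accounts for the completion.\<close>

lemma shifted_path_in_sets_completion:
  fixes X :: "real \<Rightarrow> 'w \<Rightarrow> 'v::euclidean_space"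
  assumes X: "\<And>t. 0 \<le> t \<Longrightarrow> X t \<in> N \<rightarrow>\<^sub>M borel"
    and cont: "AE \<omega> in N. continuous_on {0..} (\<lambda>t. X t \<omega>)"
    and T [measurable]: "T \<in> borel_measurable N" and B: "B \<in> sets path_space"
  shows "{\<omega>\<in>space N. T \<omega> < \<infinity> \<and> path (\<lambda>s. X (enn2real (T \<omega>) + s)) \<omega> \<in> B} \<in> sets (completion N)"
proof -
  obtain E where E: "{\<omega>\<in>space N. \<not> continuous_on {0..} (\<lambda>t. X t \<omega>)} \<subseteq> E" "E \<in> null_sets N"
    using AE_E[OF cont] by (metis null_setsI)
  \<comment> \<open>\<open>T\<close> rounded down to the grid of mesh 1/(n+1). Only measurability is
    at stake, so these values need not be stopping times.\<close>
  let ?f = "\<lambda>n \<omega>. real (nat \<lfloor>real (Suc n) * enn2real (T \<omega>)\<rfloor>) / real (Suc n)"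
  \<comment> \<open>On the exceptional null set \<open>E\<close> the value 0 is put in to get
    convergence everywhere. Where \<open>T\<close> is infinite, \<open>enn2real\<close> returns 0,
    but the event requires \<open>T\<close> finite.\<close>
  define Z where "Z s \<omega> = (if \<omega> \<in> E then 0 else X (enn2real (T \<omega>) + s) \<omega>)" for s \<omega>
  have "Z s \<in> N \<rightarrow>\<^sub>M borel" if s: "0 \<le> s" for s
  proof (rule borel_measurable_LIMSEQ_metric)
    fix n
    have "(\<lambda>\<omega>. X (real (nat \<lfloor>real (Suc n) * enn2real (T \<omega>)\<rfloor>) / real (Suc n) + s) \<omega>) \<in> N \<rightarrow>\<^sub>M borel"
      by (rule measurable_compose_countable[where g="\<lambda>\<omega>. nat \<lfloor>real (Suc n) * enn2real (T \<omega>)\<rfloor>"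
            and f="\<lambda>k. X (real k / real (Suc n) + s)"]) (use s X in auto)
    then show "(\<lambda>\<omega>. if \<omega> \<in> E then 0 else X (?f n \<omega> + s) \<omega>) \<in> N \<rightarrow>\<^sub>M borel"
      using E(2) by (intro measurable_If_set) auto
  next
    fix \<omega> assume "\<omega> \<in> space N"
    show "(\<lambda>n. if \<omega> \<in> E then 0 else X (?f n \<omega> + s) \<omega>) \<longlonglongrightarrow> Z s \<omega>"
    proof (cases "\<omega> \<in> E")
      case False
      then have c: "continuous_on {0..} (\<lambda>t. X t \<omega>)" using E(1) \<open>\<omega> \<in> space N\<close> by auto
      let ?r = "enn2real (T \<omega>)"
      have "(\<lambda>n. ?f n \<omega>) \<longlonglongrightarrow> ?r"
      proof (rule real_tendsto_sandwich)
        show "\<forall>\<^sub>F n in sequentially. ?r - 1 / real (Suc n) \<le> ?f n \<omega>"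
        proof (rule always_eventually, rule allI)
          fix n
          have "real (Suc n) * ?r - 1 \<le> real (nat \<lfloor>real (Suc n) * ?r\<rfloor>)" by linarith
          then have "(real (Suc n) * ?r - 1) / real (Suc n) \<le> ?f n \<omega>"
            by (intro divide_right_mono) auto
          then show "?r - 1 / real (Suc n) \<le> ?f n \<omega>" by (simp add: diff_divide_distrib)
        qed
        show "\<forall>\<^sub>F n in sequentially. ?f n \<omega> \<le> ?r"
        proof (rule always_eventually, rule allI)
          fix n
          have "real (nat \<lfloor>real (Suc n) * ?r\<rfloor>) \<le> real (Suc n) * ?r" by simp
          then have "?f n \<omega> \<le> real (Suc n) * ?r / real (Suc n)"
            by (intro divide_right_mono) auto
          then show "?f n \<omega> \<le> ?r" by simp
        qed
        show "(\<lambda>n. ?r - 1 / real (Suc n)) \<longlonglongrightarrow> ?r"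
          using tendsto_diff[OF tendsto_const LIMSEQ_inverse_real_of_nat, of ?r]
          by (simp add: inverse_eq_divide)
      qed simp
      then have "(\<lambda>n. ?f n \<omega> + s) \<longlonglongrightarrow> ?r + s" by (intro tendsto_intros)
      then have "(\<lambda>n. X (?f n \<omega> + s) \<omega>) \<longlonglongrightarrow> X (?r + s) \<omega>"
        by (rule continuous_on_tendsto_compose[OF c]) (use s in auto)
      then show ?thesis using False by (simp add: Z_def)
    qed (simp add: Z_def)
  qed
  then have Zp: "path Z \<in> N \<rightarrow>\<^sub>M path_space" by (rule measurable_path)
  have "{\<omega>\<in>space N. T \<omega> < \<infinity>} \<in> sets N" by measurable
  from sets.Int[OF this measurable_sets_Collect_in[OF Zp B]]
  have S: "{\<omega>\<in>space N. T \<omega> < \<infinity> \<and> path Z \<omega> \<in> B} \<in> sets N"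
    by (simp add: Int_def conj_ac cong: conj_cong)
  have "AE \<omega> in N. \<omega> \<in> {\<omega>\<in>space N. T \<omega> < \<infinity> \<and> path Z \<omega> \<in> B} \<longleftrightarrow>
      T \<omega> < \<infinity> \<and> path (\<lambda>s. X (enn2real (T \<omega>) + s)) \<omega> \<in> B"
    using AE_not_in[OF E(2)] AE_space
  proof eventually_elim
    case (elim \<omega>)
    then have "path Z \<omega> = path (\<lambda>s. X (enn2real (T \<omega>) + s)) \<omega>"
      by (auto simp: path_def Z_def)
    then show ?case using elim by simp
  qed
  from completion_AE_eq(1)[OF S this] show ?thesis .
qed

text \<open>Applied with \<open>D\<close> the boundary of the alcove. The remaining time \<open>t - T\<close> is random, while the
  strong Markov property concerns a fixed event, hence the sets \<open>A\<close>: on each of them \<open>t - T\<close> is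
  constant up to $1/n$.\<close>

lemma strong_markov_sum_eq_0:
  fixes P :: "'v::euclidean_space \<Rightarrow> 'w measure" and c :: "'q \<Rightarrow> real"
  assumes fam: "process_family M P X" and sm: "strong_markov M P X"
    and cont: "AE \<omega> in P x. continuous_on {0..} (\<lambda>t. X t \<omega>)"
    and T: "stopping_time (natural_filtration M X) T" and J: "finite J"
    and B: "\<And>j. j \<in> J \<Longrightarrow> B j \<in> sets path_space"
    and bd: "AE \<omega> in P x. T \<omega> < \<infinity> \<longrightarrow> X (enn2real (T \<omega>)) \<omega> \<in> D"
    and zero: "\<And>y. y \<in> D \<Longrightarrow> (\<Sum>j\<in>J. c j * measure (P y) {\<omega>\<in>space (P y). path X \<omega> \<in> B j}) = 0"
    and A: "A \<in> sets (filtration.pre_sigma (space M) (natural_filtration M X) T)"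
      "\<And>\<omega>. \<omega> \<in> A \<Longrightarrow> T \<omega> < \<infinity>"
  shows "(\<Sum>j\<in>J. c j * measure (completion (P x))
      (A \<inter> {\<omega>\<in>space M. T \<omega> < \<infinity> \<and> path (\<lambda>s. X (enn2real (T \<omega>) + s)) \<omega> \<in> B j})) = 0"
    and "\<And>j. j \<in> J \<Longrightarrow>
      A \<inter> {\<omega>\<in>space M. T \<omega> < \<infinity> \<and> path (\<lambda>s. X (enn2real (T \<omega>) + s)) \<omega> \<in> B j} \<in> sets (completion (P x))"
proof -
  interpret prob_space "P x" by (rule process_familyD(2)[OF fam])
  interpret C: prob_space "completion (P x)" by (rule prob_space_completion)
  note sp = process_familyD(4)[OF fam, of x] and Xm = process_familyD(6)[OF fam, of _ x]
  interpret F: filtration "space M" "natural_filtration M X" by (rule filtration_natural_filtration)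
  have subF: "sets (natural_filtration M X u) \<subseteq> sets (P x)" for u
    using Xm sp by (intro sets_natural_filtration_subset) auto
  let ?G = "F.pre_sigma T"
  have sub: "subalgebra (completion (P x)) ?G"
  proof -
    \<comment> \<open>At the index \<open>top\<close> the condition on \<open>T\<close> is vacuous,
      so \<open>S\<close> itself belongs to the natural filtration at \<open>top\<close>.\<close>
    have "S \<in> sets (P x)" if "S \<in> sets ?G" for S
      using F.sets_pre_sigmaD[OF T that, of top] subF by auto
    then show ?thesis
      unfolding subalgebra_def F.space_pre_sigma using sp by (auto intro: sets_completionI_sets)
  qed
  interpret S: finite_measure_subalgebra "completion (P x)" ?G
    by unfold_locales (rule sub)
  let ?E = "\<lambda>j. {\<omega>\<in>space M. T \<omega> < \<infinity> \<and> path (\<lambda>s. X (enn2real (T \<omega>) + s)) \<omega> \<in> B j}"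
  have Tm: "T \<in> borel_measurable (P x)"
    by (rule measurable_stopping_time[OF T subF]) (simp add: space_natural_filtration sp)
  have E: "?E j \<in> sets (completion (P x))" if "j \<in> J" for j
    using shifted_path_in_sets_completion[OF Xm cont Tm B[OF that]] by (simp add: sp)
  have Ac: "A \<in> sets (completion (P x))" using A(1) sub by (auto simp: subalgebra_def)
  then show "A \<inter> ?E j \<in> sets (completion (P x))" if "j \<in> J" for j using E[OF that] by auto
  let ?R = "\<lambda>j. real_cond_exp (completion (P x)) ?G (indicator (?E j))"
  have int: "integrable (completion (P x)) (indicator (?E j) :: _ \<Rightarrow> real)" if "j \<in> J" for j
    using E[OF that] by (intro C.integrable_const_bound[of _ 1]) (auto simp: indicator_def)
  have intR: "set_integrable (completion (P x)) A (?R j)" if "j \<in> J" for j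
    unfolding set_integrable_def
    using S.real_cond_exp_int(1)[OF int[OF that]] Ac by (rule integrable_mult_indicator[rotated])
  have meas: "measure (completion (P x)) (A \<inter> ?E j) = (LINT \<omega>:A|completion (P x). ?R j \<omega>)" if "j \<in> J" for j
  proof -
    have "measure (completion (P x)) (A \<inter> ?E j) = (LINT \<omega>:A|completion (P x). indicator (?E j) \<omega>)"
      using sets.sets_into_space[OF Ac]
      by (simp add: set_lebesgue_integral_def indicator_inter_arith[symmetric] Int_absorb2 le_infI1)
    also have "\<dots> = (LINT \<omega>:A|completion (P x). ?R j \<omega>)"
      by (rule S.real_cond_exp_intA[OF int[OF that] A(1)])
    finally show ?thesis .
  qed
  have "AE \<omega> in P x. \<forall>j\<in>J. T \<omega> < \<infinity> \<longrightarrow>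
      ?R j \<omega> = measure (P (X (enn2real (T \<omega>)) \<omega>)) {\<omega>'\<in>space (P (X (enn2real (T \<omega>)) \<omega>)). path X \<omega>' \<in> B j}"
    using sm T B J unfolding strong_markov_def by (intro AE_finite_allI) blast+
  \<comment> \<open>The conditional expectations are values at \<open>X_T\<close>, which lies in
    \<open>D\<close>, so their signed sum vanishes by \<open>zero\<close>; integration over
    \<open>A\<close> then gives the claim.\<close>
  then have "AE \<omega> in P x. \<omega> \<in> A \<longrightarrow> (\<Sum>j\<in>J. c j * ?R j \<omega>) = 0"
    using bd by eventually_elim (auto simp: zero dest: A(2))
  then have ae: "AE \<omega> in completion (P x). \<omega> \<in> A \<longrightarrow> (\<Sum>j\<in>J. c j * ?R j \<omega>) = 0"
    by (rule AE_completion)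
  have "(\<Sum>j\<in>J. c j * measure (completion (P x)) (A \<inter> ?E j)) =
      (\<Sum>j\<in>J. LINT \<omega>:A|completion (P x). c j * ?R j \<omega>)"
    using intR meas by (intro sum.cong) auto
  also have "\<dots> = (LINT \<omega>|completion (P x). (\<Sum>j\<in>J. indicator A \<omega> *\<^sub>R (c j * ?R j \<omega>)))"
    unfolding set_lebesgue_integral_def using intR
    by (intro Bochner_Integration.integral_sum[symmetric]) (auto simp: set_integrable_def mult.left_commute)
  also have "\<dots> = (LINT \<omega>|completion (P x). 0)"
  proof (rule integral_cong_AE)
    show "AE \<omega> in completion (P x). (\<Sum>j\<in>J. indicator A \<omega> *\<^sub>R (c j * ?R j \<omega>)) = 0"
      using ae by eventually_elim (auto simp: indicator_def)
  qed (use Ac borel_measurable_cond_exp2 in auto)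
  finally show "(\<Sum>j\<in>J. c j * measure (completion (P x)) (A \<inter> ?E j)) = 0" by simp
qed

section \<open>Rounding the time left after the exit\<close>

lemma open_alcove_C: "open alcove_C"
  unfolding alcove_C_eq_chamber by (rule open_chamber)

lemma alcove_C_neq_UNIV: "alcove_C \<noteq> UNIV"
  unfolding alcove_C_eq_chamber by (rule chamber_neq_UNIV) simp

lemma continuous_on_shift:
  fixes f :: "real \<Rightarrow> 'a::topological_space"
  assumes "continuous_on {0..} f" "0 \<le> r"
  shows "continuous_on {0..} (\<lambda>s. f (r + s))"
  by (rule continuous_on_compose2[OF assms(1)]) (use assms(2) in \<open>auto intro!: continuous_intros\<close>)

text \<open>The remaining time is rounded up by at most 1/(n+1). A path surviving through
  \<open>t\<close> survives slightly longer, as chambers are open, so the overshoot is eventually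
  harmless. A failure at some \<open>s \<le> t\<close> cannot precede the exit, since the alcove
  lies in every chamber, and the rounded window contains it.\<close>

lemma survival_after_exit_tendsto:
  fixes X :: "real \<Rightarrow> 'w \<Rightarrow> real^'n::{finite,linorder}"
  assumes cont: "continuous_on {0..} (\<lambda>t. X t \<omega>)" and X0: "X 0 \<omega> \<in> alcove_C"
    and Q: "{} \<notin> Q" and t: "0 \<le> t"
  shows "\<forall>\<^sub>F n in sequentially.
    (hitting_time X alcove_C \<omega> \<le> ennreal t \<and>
      path (\<lambda>s. X (enn2real (hitting_time X alcove_C \<omega>) + s)) \<omega> \<in>
      survive Q (real (Suc (nat \<lfloor>real (Suc n) * (t - enn2real (hitting_time X alcove_C \<omega>))\<rfloor>)) / real (Suc n)))
    \<longleftrightarrow> (hitting_time X alcove_C \<omega> \<le> ennreal t \<and> (\<forall>s\<in>{0..t}. \<forall>b\<in>Q. X s \<omega> \<in> chamber b))"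
proof (cases "hitting_time X alcove_C \<omega> \<le> ennreal t")
  case True
  define r where "r = enn2real (hitting_time X alcove_C \<omega>)"
  have T: "hitting_time X alcove_C \<omega> = ennreal r" "0 \<le> r"
    using True by (auto simp: r_def less_top[symmetric] top_unique intro!: ennreal_enn2real[symmetric])
  then have "r \<le> t" using True t by simp
  note before = hitting_time_finiteD(2)[of X, OF cont open_alcove_C alcove_C_neq_UNIV X0 T]
  \<comment> \<open>\<open>Suc\<close> rounds up rather than down, so that the window after
    \<open>r\<close> always covers the time up to \<open>t\<close>.\<close>
  define a where "a n = real (Suc (nat \<lfloor>real (Suc n) * (t - r)\<rfloor>)) / real (Suc n)" for n
  have a_ge: "t - r \<le> a n" for n
  proof -
    have "real (Suc n) * (t - r) \<le> real (Suc (nat \<lfloor>real (Suc n) * (t - r)\<rfloor>))"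
      by linarith
    then show ?thesis by (simp add: a_def pos_le_divide_eq mult.commute)
  qed
  have a_le: "a n \<le> t - r + 1 / real (Suc n)" for n
  proof -
    have "0 \<le> real (Suc n) * (t - r)" using \<open>r \<le> t\<close> by simp
    then have "real (Suc (nat \<lfloor>real (Suc n) * (t - r)\<rfloor>)) \<le> real (Suc n) * (t - r) + 1"
      by linarith
    then have "a n \<le> (real (Suc n) * (t - r) + 1) / real (Suc n)"
      unfolding a_def by (rule divide_right_mono) simp
    then show ?thesis by (simp add: add_divide_distrib)
  qed
  have mem: "path (\<lambda>s. X (r + s)) \<omega> \<in> survive Q (a n) \<longleftrightarrow>
      (\<forall>s\<in>{0..a n}. \<forall>b\<in>Q. X (r + s) \<omega> \<in> chamber b)" for n
    using T(2) a_ge[of n] \<open>r \<le> t\<close> by (intro path_mem_survive_iff continuous_on_shift[OF cont] Q) auto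
  have "\<forall>\<^sub>F n in sequentially. path (\<lambda>s. X (r + s)) \<omega> \<in> survive Q (a n) \<longleftrightarrow>
      (\<forall>s\<in>{0..t}. \<forall>b\<in>Q. X s \<omega> \<in> chamber b)"
  proof (cases "\<forall>s\<in>{0..t}. \<forall>b\<in>Q. X s \<omega> \<in> chamber b")
    case all: True
    have "open (\<Inter>b\<in>Q. chamber b)" by (intro open_INT) (auto simp: open_chamber)
    moreover have "X t \<omega> \<in> (\<Inter>b\<in>Q. chamber b)" using all t by auto
    moreover have "((\<lambda>s. X s \<omega>) \<longlongrightarrow> X t \<omega>) (at t within {0..})"
      using cont t by (auto simp: continuous_on_def)
    ultimately have "\<forall>\<^sub>F s in at t within {0..}. X s \<omega> \<in> (\<Inter>b\<in>Q. chamber b)"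
      by (metis topological_tendstoD)
    then obtain d where d: "d > 0"
      "\<And>s. 0 \<le> s \<Longrightarrow> s \<noteq> t \<Longrightarrow> dist s t < d \<Longrightarrow> X s \<omega> \<in> (\<Inter>b\<in>Q. chamber b)"
      unfolding eventually_at by auto
    obtain n0 where n0: "1 / real (Suc n0) < d"
      using reals_Archimedean[OF d(1)] by (auto simp: inverse_eq_divide)
    have "path (\<lambda>s. X (r + s)) \<omega> \<in> survive Q (a n)" if "n0 \<le> n" for n
      unfolding mem
    proof (intro ballI)
      fix s b assume s: "s \<in> {0..a n}" and b: "b \<in> Q"
      have "1 / real (Suc n) \<le> 1 / real (Suc n0)" using that by (simp add: frac_le)
      then have "r + s < t + d" using s a_le[of n] n0 by auto
      show "X (r + s) \<omega> \<in> chamber b"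
      proof (cases "r + s \<le> t")
        case True
        then show ?thesis using all s T(2) b by auto
      next
        case False
        then have "X (r + s) \<omega> \<in> (\<Inter>b\<in>Q. chamber b)"
          using \<open>r + s < t + d\<close> s T(2) by (intro d(2)) (auto simp: dist_real_def)
        then show ?thesis using b by blast
      qed
    qed
    then show ?thesis using all by (auto simp: eventually_sequentially)
  next
    case False
    then obtain s b where s: "s \<in> {0..t}" "b \<in> Q" "X s \<omega> \<notin> chamber b" by blast
    have "r \<le> s"
    proof (rule ccontr)
      assume "\<not> r \<le> s"
      then have "X s \<omega> \<in> alcove_C" using before s by auto
      then show False using s(3) chamber_mono[of b UNIV] by (auto simp: alcove_C_eq_chamber)
    qed
    have "path (\<lambda>s. X (r + s)) \<omega> \<notin> survive Q (a n)" for n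
      unfolding mem using s \<open>r \<le> s\<close> a_ge[of n] by (auto intro!: bexI[of _ "s - r"] bexI[of _ b])
    then show ?thesis using False by simp
  qed
  then show ?thesis
    using True unfolding r_def[symmetric] a_def by simp
qed simp

text \<open>For fixed \<open>n\<close> the signed sum vanishes on each cell \<open>A n k\<close>,
  where the rounded remaining time is the constant (k+1)/(n+1), hence for the rounded events
  \<open>G n Q\<close>. Dominated convergence then removes the rounding.\<close>

lemma sum_survival_after_exit_eq_0:
  fixes P :: "real^'n::{finite,linorder} \<Rightarrow> 'w measure"
  assumes refl: "reflectable affine_weyl_C M P X" and x: "x \<in> alcove_C" and t: "0 \<le> t"
  shows "(\<Sum>Q\<in>matchings UNIV. matching_sign UNIV Q * measure (completion (P x))
      {\<omega>\<in>space (P x). hitting_time X alcove_C \<omega> \<le> ennreal t \<and>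
        (\<forall>s\<in>{0..t}. \<forall>b\<in>Q. X s \<omega> \<in> chamber b)}) = 0" (is "(\<Sum>Q\<in>_. _ * measure _ (?F Q)) = 0")
    and "\<And>Q. Q \<in> matchings UNIV \<Longrightarrow> {\<omega>\<in>space (P x). hitting_time X alcove_C \<omega> \<le> ennreal t \<and>
        (\<forall>s\<in>{0..t}. \<forall>b\<in>Q. X s \<omega> \<in> chamber b)} \<in> sets (completion (P x))"
proof -
  have fam: "process_family M P X" and sm: "strong_markov M P X"
    and cont: "AE \<omega> in P x. continuous_on {0..} (\<lambda>t. X t \<omega>)"
    using refl unfolding reflectable_def by blast+
  interpret prob_space "P x" by (rule process_familyD(2)[OF fam])
  interpret C: prob_space "completion (P x)" by (rule prob_space_completion)
  note sp = process_familyD(4)[OF fam, of x] and Xm = process_familyD(6)[OF fam, of _ x]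
  define T where "T = hitting_time X alcove_C"
  have stT: "stopping_time (natural_filtration M X) T"
    unfolding T_def by (rule stopping_time_hitting_time)
  interpret F: filtration "space M" "natural_filtration M X" by (rule filtration_natural_filtration)
  have fin: "finite (matchings (UNIV :: 'n set))" by (rule finite_matchings) simp
  let ?N = "completion (P x)"
  have good: "AE \<omega> in P x. continuous_on {0..} (\<lambda>t. X t \<omega>) \<and> X 0 \<omega> \<in> alcove_C"
    using cont process_familyD(5)[OF fam, of x] by eventually_elim (use x in auto)
  have bd: "AE \<omega> in P x. T \<omega> < \<infinity> \<longrightarrow> X (enn2real (T \<omega>)) \<omega> \<in> closure alcove_C - alcove_C"
    using good
  proof eventually_elim
    case (elim \<omega>)
    show ?case
    proof
      assume "T \<omega> < \<infinity>"
      then have "T \<omega> = ennreal (enn2real (T \<omega>))" by simp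
      from hitting_time_finiteD(1,3)[of X, OF _ open_alcove_C alcove_C_neq_UNIV _ this[unfolded T_def]] elim
      show "X (enn2real (T \<omega>)) \<omega> \<in> closure alcove_C - alcove_C" by (simp add: T_def)
    qed
  qed
  define A where "A n k = {\<omega>\<in>space M. T \<omega> \<le> ennreal t \<and> nat \<lfloor>real (Suc n) * (t - enn2real (T \<omega>))\<rfloor> = k}" for n k
  define E where "E n k Q = {\<omega>\<in>space M. T \<omega> < \<infinity> \<and>
      path (\<lambda>s. X (enn2real (T \<omega>) + s)) \<omega> \<in> survive Q (real (Suc k) / real (Suc n))}" for n k and Q :: "'n set set"
  define G where "G n Q = {\<omega>\<in>space (P x). T \<omega> \<le> ennreal t \<and>
      path (\<lambda>s. X (enn2real (T \<omega>) + s)) \<omega> \<in>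
      survive Q (real (Suc (nat \<lfloor>real (Suc n) * (t - enn2real (T \<omega>))\<rfloor>)) / real (Suc n))}" for n and Q :: "'n set set"
  have A_fin: "T \<omega> < \<infinity>" if "\<omega> \<in> A n k" for \<omega> n k
    using that by (auto simp: A_def intro: le_less_trans)
  have A_sets: "A n k \<in> sets (F.pre_sigma T)" for n k
  proof -
    note [measurable] = F.measurable_stopping_time_pre_sigma[OF stT]
    have "{\<omega>\<in>space (F.pre_sigma T). T \<omega> \<le> ennreal t \<and>
        nat \<lfloor>real (Suc n) * (t - enn2real (T \<omega>))\<rfloor> = k} \<in> sets (F.pre_sigma T)"
      by measurable
    then show ?thesis by (simp add: A_def F.space_pre_sigma)
  qed
  have AE_sum: "(\<Sum>Q\<in>matchings UNIV. matching_sign UNIV Q * measure ?N (A n k \<inter> E n k Q)) = 0"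
    and AE_sets: "\<And>Q. Q \<in> matchings UNIV \<Longrightarrow> A n k \<inter> E n k Q \<in> sets ?N" for n k
    unfolding E_def
    by (rule strong_markov_sum_eq_0[OF fam sm cont stT fin survive_in_sets bd _ A_sets A_fin],
        rule sum_survive_boundary_eq_0[OF refl]; simp)+
  \<comment> \<open>Since \<open>T\<close> is nonnegative, only finitely many cells occur, so finite
    additivity suffices.\<close>
  have G_eq: "G n Q = (\<Union>k\<le>nat \<lfloor>real (Suc n) * t\<rfloor>. A n k \<inter> E n k Q)" for n Q
  proof -
    have "nat \<lfloor>real (Suc n) * (t - enn2real (T \<omega>))\<rfloor> \<le> nat \<lfloor>real (Suc n) * t\<rfloor>" for \<omega>
      by (intro nat_mono floor_mono mult_left_mono) auto
    moreover have "T \<omega> \<le> ennreal t \<Longrightarrow> T \<omega> < \<infinity>" for \<omega> by (auto intro: le_less_trans)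
    ultimately show ?thesis unfolding G_def A_def E_def sp by auto
  qed
  have G_sets: "G n Q \<in> sets ?N" if "Q \<in> matchings UNIV" for n Q
    unfolding G_eq using AE_sets that by (intro sets.finite_UN) auto
  have G_meas: "measure ?N (G n Q) = (\<Sum>k\<le>nat \<lfloor>real (Suc n) * t\<rfloor>. measure ?N (A n k \<inter> E n k Q))"
    if "Q \<in> matchings UNIV" for n Q
    unfolding G_eq using AE_sets that
    by (intro C.finite_measure_finite_Union) (auto simp: disjoint_family_on_def A_def)
  have G_sum: "(\<Sum>Q\<in>matchings UNIV. matching_sign UNIV Q * measure ?N (G n Q)) = 0" for n
  proof -
    have "(\<Sum>Q\<in>matchings UNIV. matching_sign UNIV Q * measure ?N (G n Q)) =
        (\<Sum>k\<le>nat \<lfloor>real (Suc n) * t\<rfloor>. \<Sum>Q\<in>matchings UNIV.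
          matching_sign UNIV Q * measure ?N (A n k \<inter> E n k Q))"
      by (subst sum.swap) (simp add: G_meas sum_distrib_left)
    then show ?thesis by (simp add: AE_sum)
  qed
  have Tm: "T \<in> borel_measurable (P x)"
    unfolding T_def using Xm by (rule measurable_hitting_time)
  have lim: "AE \<omega> in P x. \<forall>\<^sub>F n in sequentially. \<omega> \<in> G n Q \<longleftrightarrow> \<omega> \<in> ?F Q" if "Q \<in> matchings UNIV" for Q
    using good
  proof eventually_elim
    case (elim \<omega>)
    then show ?case
      using survival_after_exit_tendsto[of X \<omega> Q t] matching_nonempty_blocks[OF that] t
      unfolding G_def T_def[symmetric] by (auto elim: eventually_mono)
  qed
  show F_sets: "?F Q \<in> sets ?N" if Q: "Q \<in> matchings UNIV" for Q
  proof -
    have "{\<omega>\<in>space (P x). T \<omega> \<le> ennreal t} \<in> events" using Tm by measurable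
    moreover have "{\<omega>\<in>space (P x). path X \<omega> \<in> survive Q t} \<in> events"
      using measurable_sets_Collect_in[OF measurable_path[of X, OF Xm] survive_in_sets] .
    ultimately have S: "{\<omega>\<in>space (P x). T \<omega> \<le> ennreal t} \<inter> {\<omega>\<in>space (P x). path X \<omega> \<in> survive Q t} \<in> events"
      by (rule sets.Int)
    have "AE \<omega> in P x. \<omega> \<in> {\<omega>\<in>space (P x). T \<omega> \<le> ennreal t} \<inter> {\<omega>\<in>space (P x). path X \<omega> \<in> survive Q t}
        \<longleftrightarrow> T \<omega> \<le> ennreal t \<and> (\<forall>s\<in>{0..t}. \<forall>b\<in>Q. X s \<omega> \<in> chamber b)"
      using good AE_space
    proof eventually_elim
      case (elim \<omega>)
      then show ?case using path_mem_survive_iff[of X \<omega> Q t] matching_nonempty_blocks[OF Q] t by simp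
    qed
    from completion_AE_eq(1)[OF S this] show ?thesis by (simp add: T_def)
  qed
  have conv: "(\<lambda>n. measure ?N (G n Q)) \<longlonglongrightarrow> measure ?N (?F Q)" if Q: "Q \<in> matchings UNIV" for Q
  proof -
    have "(\<lambda>n. LINT \<omega>|?N. indicator (G n Q) \<omega> :: real) \<longlonglongrightarrow> (LINT \<omega>|?N. indicator (?F Q) \<omega>)"
    proof (rule integral_dominated_convergence[where w="\<lambda>_. 1"])
      show "AE \<omega> in ?N. (\<lambda>n. indicator (G n Q) \<omega> :: real) \<longlonglongrightarrow> indicator (?F Q) \<omega>"
        using AE_completion[OF lim[OF Q]]
      proof eventually_elim
        case (elim \<omega>)
        then have "\<forall>\<^sub>F n in sequentially. indicator (G n Q) \<omega> = (indicator (?F Q) \<omega> :: real)"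
          by eventually_elim (simp add: indicator_def)
        then show ?case by (rule tendsto_eventually)
      qed
      show "indicator (?F Q) \<in> borel_measurable ?N"
        by (rule borel_measurable_indicator[OF F_sets[OF Q]])
      show "indicator (G n Q) \<in> borel_measurable ?N" for n
        by (rule borel_measurable_indicator[OF G_sets[OF Q]])
    qed (auto simp: indicator_def)
    moreover have "?F Q \<subseteq> space ?N" "G n Q \<subseteq> space ?N" for n by (auto simp: G_def)
    ultimately show ?thesis by (simp add: Int_absorb2)
  qed
  have "(\<lambda>n. \<Sum>Q\<in>matchings UNIV. matching_sign UNIV Q * measure ?N (G n Q)) \<longlonglongrightarrow>
      (\<Sum>Q\<in>matchings UNIV. matching_sign UNIV Q * measure ?N (?F Q))"
    using conv by (intro tendsto_intros)
  then show "(\<Sum>Q\<in>matchings UNIV. matching_sign UNIV Q * measure ?N (?F Q)) = 0"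
    unfolding G_sum by (simp add: LIMSEQ_const_iff)
qed

theorem mainTheorem10:
  fixes M :: "'w measure"
    and P :: "real^'n::{finite,linorder} \<Rightarrow> 'w measure"
    and X :: "real \<Rightarrow> 'w \<Rightarrow> real^'n::{finite,linorder}"
    and x :: "real^'n::{finite,linorder}" and t :: real
  assumes "reflectable affine_weyl_C M P X"
    and "indep_orthogonal_components P X"
    and "x \<in> alcove_C"
    and "t \<ge> 0"
  shows "\<P>(\<omega> in completion (P x). exit_time X alcove_C \<omega> > ennreal t) =
    (if even CARD('n) then pfaffian UNIV (p_pair P X x t)
     else \<Sum>l\<in>UNIV. (-1) ^ card {i. i < l} * p_single P X x t l
                       * pfaffian (UNIV - {l}) (p_pair P X x t))"
proof -
  have fam: "process_family M P X"
    and cont: "AE \<omega> in P x. continuous_on {0..} (\<lambda>t. X t \<omega>)"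
    using assms(1) unfolding reflectable_def by blast+
  interpret prob_space "P x" by (rule process_familyD(2)[OF fam])
  interpret C: prob_space "completion (P x)" by (rule prob_space_completion)
  note sp = process_familyD(4)[OF fam, of x] and Xm = process_familyD(6)[OF fam, of _ x]
  let ?N = "completion (P x)"
  have good: "AE \<omega> in P x. continuous_on {0..} (\<lambda>t. X t \<omega>) \<and> X 0 \<omega> \<in> alcove_C"
    using cont process_familyD(5)[OF fam, of x] by eventually_elim (use assms(3) in auto)
  define T where "T = hitting_time X alcove_C"
  define A where "A = {\<omega>\<in>space (P x). ennreal t < T \<omega>}"
  define F where "F Q = {\<omega>\<in>space (P x). T \<omega> \<le> ennreal t \<and>
      (\<forall>s\<in>{0..t}. \<forall>b\<in>Q. X s \<omega> \<in> chamber b)}" for Q :: "'n set set"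
  define p where "p b = prob {\<omega>\<in>space M. path X \<omega> \<in> stays (chamber b) t}" for b
  have Xp: "path X \<in> P x \<rightarrow>\<^sub>M path_space" using Xm by (rule measurable_path)
  have "T \<in> borel_measurable (P x)"
    unfolding T_def using Xm by (rule measurable_hitting_time)
  then have A: "A \<in> events" unfolding A_def by measurable
  have F: "F Q \<in> C.events" if "Q \<in> matchings UNIV" for Q
    unfolding F_def T_def by (rule sum_survival_after_exit_eq_0(2)[OF assms(1,3,4) that])

  have exit: "\<P>(\<omega> in ?N. exit_time X alcove_C \<omega> > ennreal t) = C.prob A"
  proof -
    have "AE \<omega> in P x. \<omega> \<in> A \<longleftrightarrow> ennreal t < exit_time X alcove_C \<omega>"
      using good AE_space
    proof eventually_elim
      case (elim \<omega>)
      then show ?case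
        using exit_time_eq_hitting_time[of X \<omega>, OF _ open_alcove_C alcove_C_neq_UNIV]
        by (simp add: A_def T_def)
    qed
    from completion_AE_eq(2)[OF A this] A show ?thesis by simp
  qed

  \<comment> \<open>Before the exit all coordinates are in the alcove, hence in every chamber; thus
    \<open>A\<close> is, almost surely, part of every survival event, and \<open>F Q\<close> is the
    rest.\<close>
  have split: "(\<Prod>b\<in>Q. p b) = C.prob A + C.prob (F Q)" if Q: "Q \<in> matchings UNIV" for Q
  proof -
    have part: "disjoint Q" "{} \<notin> Q" "Q \<noteq> {}"
      using Q by (auto simp: matchings_def partition_on_def)
    have S: "{\<omega>\<in>space (P x). path X \<omega> \<in> survive Q t} \<in> events"
      by (rule measurable_sets_Collect_in[OF Xp survive_in_sets])
    have "AE \<omega> in P x. \<omega> \<in> {\<omega>\<in>space (P x). path X \<omega> \<in> survive Q t} \<longleftrightarrow> \<omega> \<in> A \<union> F Q"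
      using good AE_space
    proof eventually_elim
      case (elim \<omega>)
      have "path X \<omega> \<in> survive Q t \<longleftrightarrow> (\<forall>s\<in>{0..t}. \<forall>b\<in>Q. X s \<omega> \<in> chamber b)"
        using elim part assms(4) by (intro path_mem_survive_iff) auto
      moreover have "\<forall>s\<in>{0..t}. \<forall>b\<in>Q. X s \<omega> \<in> chamber b" if "ennreal t < T \<omega>"
      proof -
        have "\<forall>s\<in>{0..t}. X s \<omega> \<in> alcove_C"
          using hitting_time_le_iff[of X \<omega>, OF _ open_alcove_C alcove_C_neq_UNIV _ assms(4)] elim that
          by (auto simp: T_def)
        then show ?thesis
          using chamber_mono[of _ "UNIV :: 'n set"] by (auto simp: alcove_C_eq_chamber)
      qed
      ultimately show ?case using elim by (auto simp: A_def F_def)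
    qed
    from completion_AE_eq(2)[OF S this]
    have "prob {\<omega>\<in>space (P x). path X \<omega> \<in> survive Q t} = C.prob (A \<union> F Q)"
      by (simp add: A_def F_def Un_def conj_disj_distribL cong: conj_cong)
    also have "\<dots> = C.prob A + C.prob (F Q)"
      using A F[OF Q] by (intro C.finite_measure_Union) (auto simp: A_def F_def)
    also have "prob {\<omega>\<in>space (P x). path X \<omega> \<in> survive Q t} = (\<Prod>b\<in>Q. p b)"
      using prob_survival_indep[OF fam cont assms(2) part assms(4)]
      by (simp add: survive_def sp p_def)
    finally show ?thesis .
  qed

  have pe: "C.prob {\<omega>\<in>space (P x). \<forall>s\<in>{0..t}. X s \<omega> \<in> chamber b} = p b" if "b \<noteq> {}" for b
  proof -
    have S: "{\<omega>\<in>space (P x). path X \<omega> \<in> stays (chamber b) t} \<in> events"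
      by (rule measurable_sets_Collect_in[OF Xp stays_in_sets])
    have "AE \<omega> in P x. \<omega> \<in> {\<omega>\<in>space (P x). path X \<omega> \<in> stays (chamber b) t} \<longleftrightarrow>
        (\<forall>s\<in>{0..t}. X s \<omega> \<in> chamber b)"
      using cont AE_space
    proof eventually_elim
      case (elim \<omega>)
      then show ?case
        using path_mem_stays_iff[of X \<omega>, OF _ open_chamber chamber_neq_UNIV[OF that] assms(4)] by simp
    qed
    from completion_AE_eq(2)[OF S this] show ?thesis by (simp add: p_def sp)
  qed
  have pair: "p_pair P X x t i j = p {i, j}" if "i < j" for i j
  proof -
    have "y \<in> chamber {i, j} \<longleftrightarrow> 1/2 > y $ i \<and> y $ i > y $ j \<and> y $ j > 0" for y
      using that by (auto simp: chamber_def)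
    then show ?thesis
      using pe[of "{i, j}"] that by (simp add: p_pair_def p_ordered_def)
  qed
  have single: "p_single P X x t l = p {l}" for l
    using pe[of "{l}"] by (simp add: p_single_def chamber_def conj_commute)

  \<comment> \<open>The probability of \<open>A\<close> is the same for all matchings, so it is
    multiplied by the total sign 1, while the contributions of \<open>F Q\<close> cancel.\<close>
  have "(\<Sum>Q\<in>matchings UNIV. matching_sign UNIV Q * (\<Prod>b\<in>Q. p b)) =
      C.prob A * (\<Sum>Q\<in>matchings (UNIV :: 'n set). matching_sign UNIV Q) +
      (\<Sum>Q\<in>matchings UNIV. matching_sign UNIV Q * C.prob (F Q))"
    by (simp add: split distrib_left sum.distrib sum_distrib_right mult.commute)
  also have "\<dots> = C.prob A"
    using sum_survival_after_exit_eq_0(1)[OF assms(1,3,4)]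
    by (simp add: sum_matching_sign F_def T_def)
  finally have "C.prob A = (if even CARD('n) then pfaffian UNIV (p_pair P X x t)
      else \<Sum>l\<in>UNIV. (-1) ^ card {i\<in>UNIV. i < l} * p {l} * pfaffian (UNIV - {l}) (p_pair P X x t))"
    by (subst (asm) sum_matchings_eq_pfaffian[of UNIV "p_pair P X x t" p, OF _ pair]) simp_all
  then show ?thesis
    unfolding exit single by (simp only: UNIV_I simp_thms)
qed

end
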